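(* Let $(G,k)$ be a minimum counterexample (in the sense defined in the context). Then the following statements hold. (a) $k\geq 3$; (b) $|col(G)|=2$ or $|col(G)|=3$; (c) $G$ contains no rainbow triangle; (d) $G$ contains no monochromatic edge-cut; (e) for each set $S\subseteq V(G)$ with $|S|\leq k-1$ and each vertex $v\in V(G)\setminus S$, there exists a properly colored cycle of length $4$ in $G-S$ containing $v$.
   Context: All graphs are finite and simple. An edge-colored graph is a graph with an arbitrary mapping $col:E(G)\to\mathbb{N}$ (not necessarily a proper coloring); $col(G)$ denotes the set of colors appearing on $E(G)$. For a color $i$, $G^i$ is the spanning subgraph of $G$ formed by the edges of color $i$, and $\Delta^{mon}(G)=\max_{i\in col(G)} \Delta(G^i)$ is the maximum monochromatic degree. A cycle is properly colored (PC) if any two adjacent edges of the cycle have distinct colors. A rainbow triangle is a cycle of length $3$ whose three edges have pairwise distinct colors. $G$ contains a monochromatic edge-cut if $V(G)$ can be partitioned into two nonempty sets $V_1,V_2$ such that all edges between $V_1$ and $V_2$ have the same color. A counterexample is a pair $(G,k)$, where $k\geq 1$ is an integer and $G$ is an edge-colored complete graph on $n=|V(G)|$ vertices, such that $\Delta^{mon}(G)\leq n-3k+1$ but $G$ does not contain $k$ pairwise vertex-disjoint PC cycles of length at most $4$. (It is conjectured that no counterexample exists.) A minimum counterexample is a counterexample $(G,k)$ such that, among all counterexamples, $k$ is as small as possible; subject to this, $|V(G)|$ is as small as possible; and subject to this, $|col(G)|$ is as small as possible. *)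

theory Defs
  imports Main "HOL-Library.Disjoint_Sets"
begin

text \<open>Edges are two-element vertex sets; the values of \<open>ecol\<close> outside \<open>edges\<close> are irrelevant.\<close>

record 'a ecgraph =
  verts :: "'a set"
  edges :: "'a set set"
  ecol :: "'a set \<Rightarrow> nat"

definition is_graph :: "'a ecgraph \<Rightarrow> bool" where
  "is_graph G \<longleftrightarrow> finite (verts G) \<and> edges G \<subseteq> {e. e \<subseteq> verts G \<and> card e = 2}"

definition is_complete :: "'a ecgraph \<Rightarrow> bool" where
  "is_complete G \<longleftrightarrow> is_graph G \<and> edges G = {e. e \<subseteq> verts G \<and> card e = 2}"

definition colors :: "'a ecgraph \<Rightarrow> nat set" where
  "colors G = ecol G ` edges G"

definition color_subgraph :: "'a ecgraph \<Rightarrow> nat \<Rightarrow> 'a ecgraph" where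
  "color_subgraph G i = G\<lparr>edges := {e \<in> edges G. ecol G e = i}\<rparr>"

definition degree :: "'a ecgraph \<Rightarrow> 'a \<Rightarrow> nat" where
  "degree G v = card {e \<in> edges G. v \<in> e}"

text \<open>The inserted \<open>0\<close> fixes the maximum over the empty set; it changes nothing otherwise.\<close>

definition max_degree :: "'a ecgraph \<Rightarrow> nat" where
  "max_degree G = Max (insert 0 (degree G ` verts G))"

definition max_mono_degree :: "'a ecgraph \<Rightarrow> nat" where
  "max_mono_degree G = Max (insert 0 ((\<lambda>i. max_degree (color_subgraph G i)) ` colors G))"

definition delete_verts :: "'a ecgraph \<Rightarrow> 'a set \<Rightarrow> 'a ecgraph" where
  "delete_verts G S = G\<lparr>verts := verts G - S, edges := {e \<in> edges G. e \<inter> S = {}}\<rparr>"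

text \<open>A cycle is given by the list of its vertices in cyclic order, without repeating the
  first one at the end; its length is the length of the list.\<close>

definition cycle_edges :: "'a list \<Rightarrow> 'a set set" where
  "cycle_edges xs = (\<lambda>i. {xs ! i, xs ! (Suc i mod length xs)}) ` {..<length xs}"

definition is_cycle :: "'a ecgraph \<Rightarrow> 'a list \<Rightarrow> bool" where
  "is_cycle G xs \<longleftrightarrow> length xs \<ge> 3 \<and> distinct xs \<and> set xs \<subseteq> verts G \<and> cycle_edges xs \<subseteq> edges G"

definition pc_cycle :: "'a ecgraph \<Rightarrow> 'a list \<Rightarrow> bool" where
  "pc_cycle G xs \<longleftrightarrow> is_cycle G xs \<and>
     (\<forall>e\<in>cycle_edges xs. \<forall>f\<in>cycle_edges xs. e \<noteq> f \<and> e \<inter> f \<noteq> {} \<longrightarrow> ecol G e \<noteq> ecol G f)"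

definition rainbow_triangle :: "'a ecgraph \<Rightarrow> 'a list \<Rightarrow> bool" where
  "rainbow_triangle G xs \<longleftrightarrow> is_cycle G xs \<and> length xs = 3 \<and> inj_on (ecol G) (cycle_edges xs)"

definition has_mono_edge_cut :: "'a ecgraph \<Rightarrow> bool" where
  "has_mono_edge_cut G \<longleftrightarrow>
     (\<exists>V\<^sub>1 V\<^sub>2. V\<^sub>1 \<noteq> {} \<and> V\<^sub>2 \<noteq> {} \<and> V\<^sub>1 \<inter> V\<^sub>2 = {} \<and> V\<^sub>1 \<union> V\<^sub>2 = verts G \<and>
        (\<exists>i. \<forall>u\<in>V\<^sub>1. \<forall>v\<in>V\<^sub>2. {u, v} \<in> edges G \<longrightarrow> ecol G {u, v} = i))"

definition has_disjoint_short_pc_cycles :: "'a ecgraph \<Rightarrow> nat \<Rightarrow> bool" where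
  "has_disjoint_short_pc_cycles G k \<longleftrightarrow>
     (\<exists>C :: nat \<Rightarrow> 'a list. (\<forall>i<k. pc_cycle G (C i) \<and> length (C i) \<le> 4) \<and>
        disjoint_family_on (\<lambda>i. set (C i)) {..<k})"

definition counterexample :: "'a ecgraph \<Rightarrow> nat \<Rightarrow> bool" where
  "counterexample G k \<longleftrightarrow> k \<ge> 1 \<and> is_complete G \<and>
     int (max_mono_degree G) \<le> int (card (verts G)) - 3 * int k + 1 \<and>
     \<not> has_disjoint_short_pc_cycles G k"

text \<open>Competitors range over graphs on natural numbers: every finite graph has an isomorphic copy
  there, whereas \<open>'a\<close> itself could be finite and so lack counterexamples of larger order.\<close>

definition minimum_counterexample :: "'a ecgraph \<Rightarrow> nat \<Rightarrow> bool" where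
  "minimum_counterexample G k \<longleftrightarrow> counterexample G k \<and>
     (\<forall>(H :: nat ecgraph) l. counterexample H l \<longrightarrow>
        k \<le> l \<and>
        (l = k \<longrightarrow> card (verts G) \<le> card (verts H) \<and>
          (card (verts H) = card (verts G) \<longrightarrow> card (colors G) \<le> card (colors H))))"

end

theory Submission
  imports Defs
begin

text \<open>
  The engine is a statement about a vertex \<open>v\<close> of a complete graph without rainbow triangle.  Orient
  \<open>a \<rightarrow> b\<close> when the color of \<open>ab\<close> differs from that of \<open>va\<close>.  If \<open>v\<close> lies on no PC cycle of length 4,
  then after deleting a set that no arrow enters this is a multipartite tournament without directed triangles,
  whose classes are the colors at \<open>v\<close>, in which directed 4-cycles are PC cycles and all out-degrees
  are large.  A terminal strong component has only two classes, so disjoint directed 4-cycles can be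
  removed greedily.  This gives (e) and the case \<open>k = 1\<close>.

  Deleting a rainbow triangle gives (c), and a monochromatic cut yields \<open>k\<close> disjoint PC cycles
  greedily, which gives (d).  Without rainbow triangles there is a Gallai partition: at most two
  colors occur between the parts and every pair of parts is monochromatic.  Two colors occurring only
  inside the parts can be merged, which gives (b).  For \<open>k = 2\<close> the colors inside the parts can even be
  replaced, part by part, by the two colors outside, and then a vertex that is monochromatic off an
  alternating 4-cycle serves to build two disjoint alternating 4-cycles.
\<close>

section \<open>Disjoint directed 4-cycles in multipartite tournaments\<close>

text \<open>All constants come from one slack: a color degree of at most n - 3k + 1 leaves at least
  3k - 2 edges of other colors at every vertex. Deleting up to k - 1 vertices leaves 2k - 1 of them,
  which is what k greedy removals can afford when each costs at most 2 and the last still needs 1.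
  This is why (e) stops at k - 1 deleted vertices. Deleting a rainbow triangle lowers n by 3 and k
  by 1, which keeps the bound.

  Minimality enters only twice: in k for the rainbow triangle, and in the number of colors for the
  merging. Statement (d) holds for every counterexample, and (a) and (e) for every one without
  rainbow triangles, so (c) has to come before them.

  The obstacle at k = 2 is that a recoloring with two colors must keep 3k - 2 = 4 edges of each
  color at every vertex and must never separate two adjacent edges of equal color. Colors inside a
  part are therefore recolored by a decision for the whole part, and the outside edges of the part
  have to supply the other color.\<close>

locale tf_multipartite_tournament =
  fixes W :: "'a set" and cl :: "'a \<Rightarrow> 'c" and ar :: "'a \<Rightarrow> 'a \<Rightarrow> bool"
  assumes fin: "finite W"
    and ar_cl: "\<lbrakk>a \<in> W; b \<in> W; ar a b\<rbrakk> \<Longrightarrow> cl a \<noteq> cl b"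
    and ar_asym: "\<lbrakk>a \<in> W; b \<in> W; ar a b\<rbrakk> \<Longrightarrow> \<not> ar b a"
    and ar_total: "\<lbrakk>a \<in> W; b \<in> W; cl a \<noteq> cl b\<rbrakk> \<Longrightarrow> ar a b \<or> ar b a"
    and no_triangle: "\<lbrakk>a \<in> W; b \<in> W; d \<in> W; ar a b; ar b d; ar d a\<rbrakk> \<Longrightarrow> False"
begin

definition outs :: "'a set \<Rightarrow> 'a \<Rightarrow> 'a set" where
  "outs Q a = {b \<in> Q. ar a b}"

text \<open>The class equations matter later: when only two classes occur, no vertex has
  out-neighbours in both of the pairs \<open>a, c\<close> and \<open>b, d\<close>, and a vertex of a
  third class is comparable with all four.\<close>

definition dcycle4 :: "'a \<Rightarrow> 'a \<Rightarrow> 'a \<Rightarrow> 'a \<Rightarrow> bool" where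
  "dcycle4 a b c d \<longleftrightarrow> ar a b \<and> ar b c \<and> ar c d \<and> ar d a \<and> cl a = cl c \<and> cl b = cl d \<and> a \<noteq> c \<and> b \<noteq> d"

primrec dpack :: "nat \<Rightarrow> 'a set \<Rightarrow> bool" where
  "dpack 0 Q = True"
| "dpack (Suc k) Q = (\<exists>a\<in>Q. \<exists>b\<in>Q. \<exists>c\<in>Q. \<exists>d\<in>Q. dcycle4 a b c d \<and> dpack k (Q - {a, b, c, d}))"

text \<open>The reverse arrow would close a directed triangle. All closure arguments below rest on
  this partial transitivity.\<close>

lemma ar_trans:
  assumes "a \<in> W" "b \<in> W" "d \<in> W" "ar a b" "ar b d" "cl a \<noteq> cl d"
  shows "ar a d"
  using assms ar_total no_triangle by blast

lemma dpack_mono: "dpack k Q \<Longrightarrow> Q \<subseteq> Q' \<Longrightarrow> dpack k Q'"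
proof (induction k arbitrary: Q Q')
  case (Suc k)
  then obtain a b c d where *: "a \<in> Q" "b \<in> Q" "c \<in> Q" "d \<in> Q" "dcycle4 a b c d"
    "dpack k (Q - {a, b, c, d})" by auto
  have "dpack k (Q' - {a, b, c, d})"
    by (rule Suc.IH[OF *(6)]) (use Suc.prems in blast)
  with * Suc.prems(2) show ?case by (simp only: dpack.simps) blast
qed simp

text \<open>By asymmetry \<open>b\<close> is an out-neighbour of \<open>a\<close> but not of
  \<open>c\<close>, so by \<open>min\<close> some out-neighbour \<open>d\<close> of \<open>c\<close>
  is not one of \<open>a\<close> and hence points to \<open>a\<close>. If \<open>d\<close> were not
  in the class of \<open>b\<close>, then \<open>a, b, d\<close> or \<open>b, c, d\<close> would be a
  directed triangle.\<close>

lemma dcycle4_if_return: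
  assumes Q: "Q \<subseteq> W" and mem: "a \<in> Q" "b \<in> Q" "c \<in> Q"
    and min: "card (outs Q a) \<le> card (outs Q c)"
    and ab: "ar a b" and bc: "ar b c" and cl: "cl c = cl a"
  shows "\<exists>d\<in>Q. dcycle4 a b c d"
proof -
  have finQ: "finite Q" using Q fin finite_subset by blast
  have b: "b \<in> outs Q a" "b \<notin> outs Q c"
    using assms ar_asym unfolding outs_def by blast+
  have "\<not> outs Q c \<subseteq> outs Q a"
  proof
    assume "outs Q c \<subseteq> outs Q a"
    then have "outs Q c \<subset> outs Q a" using b by blast
    then have "card (outs Q c) < card (outs Q a)"
      by (rule psubset_card_mono[rotated]) (use finQ in \<open>simp add: outs_def\<close>)
    with min show False by simp
  qed
  then obtain d where d: "d \<in> Q" "ar c d" "\<not> ar a d" by (auto simp: outs_def)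
  have W: "a \<in> W" "b \<in> W" "c \<in> W" "d \<in> W" using Q mem d by auto
  have da: "ar d a" using W d cl ar_total[of a d] ar_cl[of c d] by metis
  have "cl d = cl b"
    using W ab bc d da ar_total[of b d] no_triangle[of a b d] no_triangle[of b c d] by metis
  then show ?thesis using d da ab bc cl b W ar_asym unfolding dcycle4_def by metis
qed

text \<open>In the bipartite case a 4-cycle contains at most two out-neighbours of any vertex, so its removal
  lowers out-degrees by at most 2.\<close>

lemma bipartite_dpack:
  assumes "Q \<subseteq> W" "Q \<noteq> {} \<or> k = 0" "cl ` Q \<subseteq> {A, B}"
    and "\<And>a. a \<in> Q \<Longrightarrow> 2 * k \<le> card (outs Q a) + 1"
  shows "dpack k Q"
  using assms
proof (induction k arbitrary: Q)
  case (Suc k)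
  have finQ: "finite Q" using Suc.prems fin finite_subset by blast
  have fino: "finite (outs S u)" if "S \<subseteq> Q" for S u
    using finite_subset[OF that finQ] unfolding outs_def by simp
  from Suc.prems have "Q \<noteq> {}" by simp
  then obtain a where a: "a \<in> Q" "\<And>c. c \<in> Q \<Longrightarrow> card (outs Q a) \<le> card (outs Q c)"
    using ex_has_least_nat[of "\<lambda>u. u \<in> Q" _ "\<lambda>u. card (outs Q u)"] by blast
  have "outs Q u \<noteq> {}" if "u \<in> Q" for u using Suc.prems(4)[OF that] by auto
  then have ex: "\<exists>b\<in>Q. ar u b" if "u \<in> Q" for u using that unfolding outs_def by blast
  obtain b where b: "b \<in> Q" "ar a b" using ex a by blast
  obtain c where c: "c \<in> Q" "ar b c" using ex b by blast
  \<comment> \<open>With two classes only, two consecutive arrows return to the starting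
    class.\<close>
  have "cl c = cl a"
  proof -
    have "cl a \<noteq> cl b" "cl b \<noteq> cl c" using a b c Suc.prems(1) ar_cl by blast+
    moreover have "cl a \<in> {A, B}" "cl b \<in> {A, B}" "cl c \<in> {A, B}" using a b c Suc.prems(3) by blast+
    ultimately show ?thesis by auto
  qed
  then obtain d where d: "d \<in> Q" "dcycle4 a b c d"
    using dcycle4_if_return[of Q a b c] Suc.prems(1) a b c by auto
  let ?Q = "Q - {a, b, c, d}"
  have clac: "cl a = cl c" "cl b = cl d" "a \<noteq> c" "b \<noteq> d" using d unfolding dcycle4_def by auto
  have loss: "card (outs Q u) \<le> card (outs ?Q u) + 2" if u: "u \<in> Q" for u
  proof -
    have "outs Q u \<inter> {a, c} = {} \<or> outs Q u \<inter> {b, d} = {}"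
    proof -
      have "cl u \<in> {A, B}" "cl a \<in> {A, B}" "cl b \<in> {A, B}" "cl a \<noteq> cl b"
        using u a b Suc.prems ar_cl by blast+
      then have "cl u = cl a \<or> cl u = cl b" by auto
      moreover have "w \<notin> outs Q u" if "cl u = cl w" for w
        using that u Suc.prems ar_cl unfolding outs_def by blast
      ultimately show ?thesis using clac by auto
    qed
    then have "outs Q u \<subseteq> outs ?Q u \<union> {a, c} \<or> outs Q u \<subseteq> outs ?Q u \<union> {b, d}"
      unfolding outs_def by blast
    then have "card (outs Q u) \<le> card (outs ?Q u \<union> {a, c}) \<or> card (outs Q u) \<le> card (outs ?Q u \<union> {b, d})"
      using fino[of ?Q u] card_mono by (metis Diff_subset finite.emptyI finite_UnI finite_insert)
    moreover have "card (outs ?Q u \<union> {x, y}) \<le> card (outs ?Q u) + 2" for x y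
      using card_Un_le[of "outs ?Q u" "{x, y}"] by (simp add: card_insert_if split: if_splits)
    ultimately show ?thesis by (meson order_trans)
  qed
  have "dpack k ?Q"
  proof (rule Suc.IH)
    show "?Q \<noteq> {} \<or> k = 0"
    proof (cases "k = 0")
      case False
      have "outs ?Q a \<noteq> {}" using loss[OF a(1)] Suc.prems(4)[OF a(1)] False
        by auto
      then show ?thesis unfolding outs_def by blast
    qed simp
    show "2 * k \<le> card (outs ?Q u) + 1" if "u \<in> ?Q" for u
      using loss[of u] Suc.prems(4)[of u] that by simp
  qed (use Suc.prems in auto)
  then show ?case using a b c d by (simp only: dpack.simps) blast
qed simp

text \<open>The minimal nonempty sets of this kind are the terminal strong components. Out-degrees
  inside such a set equal those in \<open>W\<close>.\<close>

definition out_closed :: "'a set \<Rightarrow> bool" where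
  "out_closed Q \<longleftrightarrow> (\<forall>a\<in>Q. \<forall>b\<in>W. ar a b \<longrightarrow> b \<in> Q)"

text \<open>A vertex of a third class either dominates a given 4-cycle or is dominated by it, and either kind
  of vertex leads to a smaller closed set.\<close>

lemma minimal_closed_two_classes:
  assumes Q: "Q \<subseteq> W" "Q \<noteq> {}" "out_closed Q"
    and min: "\<And>P. P \<subset> Q \<Longrightarrow> P \<noteq> {} \<Longrightarrow> \<not> out_closed P"
    and out: "\<And>a. a \<in> Q \<Longrightarrow> outs W a \<noteq> {}"
  shows "\<exists>A B. cl ` Q \<subseteq> {A, B}"
proof -
  have finQ: "finite Q" using Q fin finite_subset by blast
  obtain x where x: "x \<in> Q" "\<And>c. c \<in> Q \<Longrightarrow> card (outs Q x) \<le> card (outs Q c)"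
    using ex_has_least_nat[of "\<lambda>u. u \<in> Q" _ "\<lambda>u. card (outs Q u)"] Q(2) by blast
  have QW: "u \<in> W" if "u \<in> Q" for u using that Q by blast
  have stay: "g \<in> Q" if "f \<in> Q" "ar f g" "g \<in> W" for f g using that Q unfolding out_closed_def by blast
  \<comment> \<open>Otherwise transitivity would make \<open>outs Q x\<close> a smaller closed
    set.\<close>
  have "\<exists>b\<in>Q. \<exists>c\<in>Q. ar x b \<and> ar b c \<and> cl c = cl x"
  proof (rule ccontr)
    assume no: "\<not> ?thesis"
    have "out_closed (outs Q x)"
      unfolding out_closed_def
    proof (intro ballI impI)
      fix b c assume b: "b \<in> outs Q x" and c: "c \<in> W" "ar b c"
      then have b': "b \<in> Q" "ar x b" by (auto simp: outs_def)
      then have cQ: "c \<in> Q" using stay c by blast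
      then have "cl c \<noteq> cl x" using no b' c by blast
      then have "ar x c" using ar_trans[of x b c] b' c x QW by metis
      then show "c \<in> outs Q x" using cQ by (simp add: outs_def)
    qed
    moreover have "outs Q x \<subset> Q" using x QW ar_asym unfolding outs_def by blast
    moreover have "outs Q x \<noteq> {}" using out[OF x(1)] stay x unfolding outs_def by blast
    ultimately show False using min by blast
  qed
  then obtain y z where yz: "y \<in> Q" "z \<in> Q" "ar x y" "ar y z" "cl z = cl x" by blast
  then obtain w where w: "w \<in> Q" "dcycle4 x y z w"
    using dcycle4_if_return[of Q x y z] x Q by auto
  have cyc: "ar x y" "ar y z" "ar z w" "ar w x" and cls: "cl z = cl x" "cl w = cl y"
    using w unfolding dcycle4_def by auto
  have W: "x \<in> W" "y \<in> W" "z \<in> W" "w \<in> W" using QW x yz w by auto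
  define T where "T = {u \<in> Q. cl u \<noteq> cl x \<and> cl u \<noteq> cl y}"
  define T' where "T' = {u \<in> T. ar x u \<and> ar y u \<and> ar z u \<and> ar w u}"
  \<comment> \<open>By transitivity an arrow from \<open>u\<close> to one vertex of the cycle
    propagates around it, so \<open>u\<close> points to all four vertices or to none.\<close>
  have dich: "u \<in> T' \<or> (ar u x \<and> ar u y \<and> ar u z \<and> ar u w)" if u: "u \<in> T" for u
  proof -
    have "u \<in> W" "cl u \<noteq> cl x" "cl u \<noteq> cl y" "cl u \<noteq> cl z" "cl u \<noteq> cl w" using u QW cls unfolding T_def by auto
    note uc = this
    have "ar u x \<Longrightarrow> ar u y" "ar u y \<Longrightarrow> ar u z" "ar u z \<Longrightarrow> ar u w" "ar u w \<Longrightarrow> ar u x"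
      using ar_trans[of u x y] ar_trans[of u y z] ar_trans[of u z w] ar_trans[of u w x] uc W cyc by simp_all
    moreover have "ar u x \<or> ar x u" "ar u y \<or> ar y u" "ar u z \<or> ar z u" "ar u w \<or> ar w u"
      using ar_total uc W by blast+
    ultimately show ?thesis using u unfolding T'_def by blast
  qed
  have "T' = {}"
  proof (rule ccontr)
    assume ne: "T' \<noteq> {}"
    \<comment> \<open>The forward closure of \<open>T'\<close>: beyond \<open>T'\<close> one step
      into the two classes of the cycle suffices. It misses \<open>x\<close>, which points to all of
      \<open>T'\<close>.\<close>
    define P where "P = T' \<union> {g \<in> Q. g \<notin> T \<and> (\<exists>u\<in>T'. ar u g)}"
    have "out_closed P" unfolding out_closed_def
    proof (intro ballI impI)
      fix f g assume f: "f \<in> P" and g: "g \<in> W" "ar f g"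
      have fQ: "f \<in> Q" using f unfolding P_def T'_def T_def by blast
      have gQ: "g \<in> Q" using stay fQ g by blast
      have fW: "f \<in> W" using fQ QW by blast
      have gT: "g \<notin> T \<Longrightarrow> cl g = cl x \<or> cl g = cl y" using gQ unfolding T_def by blast
      show "g \<in> P"
      proof (cases "f \<in> T'")
        case True
        then have "ar x f" "ar y f" "ar z f" "ar w f" unfolding T'_def by auto
        then have "g \<in> T \<Longrightarrow> g \<in> T'"
          using ar_trans[of _ f g] W fW g cls unfolding T'_def T_def by auto
        then show ?thesis using True g gQ unfolding P_def by blast
      next
        case False
        then obtain u where u: "u \<in> T'" "ar u f" and fT: "f \<notin> T" using f unfolding P_def by blast
        have fc: "cl f = cl x \<or> cl f = cl y" using fT fQ unfolding T_def by blast
        have uW: "u \<in> W" and uc: "cl u \<noteq> cl x" "cl u \<noteq> cl y" and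
          au: "ar x u" "ar y u" "ar z u" "ar w u" using u QW unfolding T'_def T_def by auto
        show ?thesis
        proof (cases "g \<in> T")
          case False
          then have "ar u g" using gT uc ar_trans[of u f g] uW fW g u by metis
          then show ?thesis using False u gQ unfolding P_def by blast
        next
          case True
          then have gc: "cl g \<noteq> cl x" "cl g \<noteq> cl y" unfolding T_def by auto
          \<comment> \<open>A cycle vertex outside the class of \<open>f\<close> points to
            \<open>u\<close>, hence to \<open>f\<close>, hence to \<open>g\<close>. The other cycle
            vertices point to \<open>g\<close> through their successors on the cycle.\<close>
          have step: "ar s g" if "s \<in> {x, y, z, w}" "cl s \<noteq> cl f" for s
          proof -
            have s: "s \<in> W" "ar s u" "cl s \<noteq> cl g" using that W au gc cls by auto
            then have "ar s f" using ar_trans[of s u f] uW fW u that by blast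
            then show ?thesis using ar_trans[of s f g] s fW g by blast
          qed
          have "ar x g \<and> ar y g \<and> ar z g \<and> ar w g"
          proof (cases "cl f = cl x")
            case True
            then have "ar y g" "ar w g" using step cls ar_cl[OF W(1,2) cyc(1)] by auto
            then show ?thesis using ar_trans[of x y g] ar_trans[of z w g] W g cyc gc cls by auto
          next
            case False
            then have "cl f = cl y" using fc by blast
            then have "ar x g" "ar z g" using step cls False by auto
            then show ?thesis using ar_trans[of y z g] ar_trans[of w x g] W g cyc gc cls by auto
          qed
          then show ?thesis using True unfolding P_def T'_def by blast
        qed
      qed
    qed
    moreover have "P \<subseteq> Q" unfolding P_def T'_def T_def by blast
    moreover have "x \<notin> P"
      using W QW ar_asym unfolding P_def T'_def T_def by blast
    moreover have "P \<noteq> {}" using ne unfolding P_def by blast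
    ultimately show False using min[of P] x by blast
  qed
  then have dom: "ar u x" "ar u y" "ar u z" "ar u w" if "u \<in> T" for u using dich that by blast+
  have "T = {}"
  proof (rule ccontr)
    assume ne: "T \<noteq> {}"
    \<comment> \<open>The dual choice: the vertices of the two cycle classes with no arrow into
      \<open>T\<close>. It contains \<open>x\<close>, to which all of \<open>T\<close> points, and
      it is closed because an arrow followed by one into \<open>T\<close> would compose.\<close>
    define P where "P = {g \<in> Q. g \<notin> T \<and> (\<forall>u\<in>T. \<not> ar g u)}"
    have "out_closed P" unfolding out_closed_def
    proof (intro ballI impI)
      fix g h assume g: "g \<in> P" and h: "h \<in> W" "ar g h"
      then have gQ: "g \<in> Q" "g \<notin> T" "\<And>u. u \<in> T \<Longrightarrow> \<not> ar g u" unfolding P_def by auto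
      have hQ: "h \<in> Q" using stay gQ h by blast
      moreover have "h \<notin> T" using gQ h by blast
      moreover have "\<not> ar h u" if u: "u \<in> T" for u
      proof
        assume "ar h u"
        moreover have "cl g \<noteq> cl u" using u gQ unfolding T_def by force
        moreover have "u \<in> W" using u QW unfolding T_def by blast
        ultimately have "ar g u" using ar_trans[of g h u] gQ h QW by blast
        then show False using gQ u by blast
      qed
      ultimately show "h \<in> P" unfolding P_def by blast
    qed
    moreover have "x \<in> P"
      using x W QW dom(1) ar_asym unfolding P_def T_def by blast
    moreover have "P \<subset> Q" using ne unfolding P_def T_def by blast
    ultimately show False using min[of P] by blast
  qed
  then have "cl ` Q \<subseteq> {cl x, cl y}" unfolding T_def by blast
  then show ?thesis by blast
qed

theorem disjoint_dcycles4:
  assumes ne: "W \<noteq> {}" and k: "k \<ge> 1" and out: "\<And>a. a \<in> W \<Longrightarrow> 2 * k \<le> card (outs W a) + 1"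
  shows "dpack k W"
proof -
  let ?S = "{Q. Q \<subseteq> W \<and> Q \<noteq> {} \<and> out_closed Q}"
  have "finite ?S" using fin by simp
  moreover have "W \<in> ?S" using ne unfolding out_closed_def by blast
  ultimately obtain Q where Q: "Q \<in> ?S" and min': "\<forall>P\<in>?S. P \<subseteq> Q \<longrightarrow> Q = P"
    using finite_has_minimal[of ?S] by (metis (no_types, lifting) empty_iff)
  have min: "\<not> out_closed P" if "P \<subset> Q" "P \<noteq> {}" for P
    using min' that Q by blast
  have "outs W a \<noteq> {}" if "a \<in> Q" for a
    using out[of a] k that Q by auto
  then obtain A B where AB: "cl ` Q \<subseteq> {A, B}"
    using minimal_closed_two_classes[of Q] Q min by simp blast
  have "outs Q a = outs W a" if "a \<in> Q" for a
    using that Q unfolding outs_def out_closed_def by blast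
  then have "dpack k Q" using bipartite_dpack[OF _ _ AB, of k] Q out by auto
  then show ?thesis using dpack_mono Q by blast
qed

end

section \<open>Packing short properly colored cycles\<close>

definition pc4 :: "('a \<Rightarrow> 'a \<Rightarrow> 'c) \<Rightarrow> 'a \<Rightarrow> 'a \<Rightarrow> 'a \<Rightarrow> 'a \<Rightarrow> bool" where
  "pc4 e a b c d \<longleftrightarrow> distinct [a, b, c, d] \<and>
     e a b \<noteq> e b c \<and> e b c \<noteq> e c d \<and> e c d \<noteq> e d a \<and> e d a \<noteq> e a b"

definition rainbow3 :: "('a \<Rightarrow> 'a \<Rightarrow> 'c) \<Rightarrow> 'a \<Rightarrow> 'a \<Rightarrow> 'a \<Rightarrow> bool" where
  "rainbow3 e a b c \<longleftrightarrow> distinct [a, b, c] \<and> e a b \<noteq> e b c \<and> e b c \<noteq> e c a \<and> e c a \<noteq> e a b"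

definition pc4_set :: "('a \<Rightarrow> 'a \<Rightarrow> 'c) \<Rightarrow> 'a set \<Rightarrow> bool" where
  "pc4_set e X \<longleftrightarrow> (\<exists>a b c d. X = {a, b, c, d} \<and> pc4 e a b c d)"

definition rainbow3_set :: "('a \<Rightarrow> 'a \<Rightarrow> 'c) \<Rightarrow> 'a set \<Rightarrow> bool" where
  "rainbow3_set e X \<longleftrightarrow> (\<exists>a b c. X = {a, b, c} \<and> rainbow3 e a b c)"

text \<open>A triangle is properly colored exactly when it is rainbow, so these are the vertex sets
  of the PC cycles of length at most 4.\<close>

definition short_pc_set :: "('a \<Rightarrow> 'a \<Rightarrow> 'c) \<Rightarrow> 'a set \<Rightarrow> bool" where
  "short_pc_set e X \<longleftrightarrow> pc4_set e X \<or> rainbow3_set e X"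

primrec pack :: "('a \<Rightarrow> 'a \<Rightarrow> 'c) \<Rightarrow> nat \<Rightarrow> 'a set \<Rightarrow> bool" where
  "pack e 0 V = True"
| "pack e (Suc k) V = (\<exists>X\<subseteq>V. short_pc_set e X \<and> pack e k (V - X))"

definition cdeg :: "('a \<Rightarrow> 'a \<Rightarrow> 'c) \<Rightarrow> 'a set \<Rightarrow> 'a \<Rightarrow> 'c \<Rightarrow> nat" where
  "cdeg e V v c = card {w \<in> V. w \<noteq> v \<and> e v w = c}"

definition two_pc4 :: "('a \<Rightarrow> 'a \<Rightarrow> 'c) \<Rightarrow> 'a set \<Rightarrow> bool" where
  "two_pc4 e V \<longleftrightarrow> (\<exists>X Y. X \<subseteq> V \<and> Y \<subseteq> V \<and> X \<inter> Y = {} \<and> pc4_set e X \<and> pc4_set e Y)"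

lemma pack_SucI: "X \<subseteq> V \<Longrightarrow> short_pc_set e X \<Longrightarrow> pack e k (V - X) \<Longrightarrow> pack e (Suc k) V"
  by auto

lemma pack_mono: "pack e k V \<Longrightarrow> V \<subseteq> V' \<Longrightarrow> pack e k V'"
proof (induction k arbitrary: V V')
  case (Suc k)
  then obtain X where X: "X \<subseteq> V" "short_pc_set e X" "pack e k (V - X)" by auto
  have "V - X \<subseteq> V' - X" using Suc.prems(2) by blast
  then have "pack e k (V' - X)" by (rule Suc.IH[OF X(3)])
  moreover have "X \<subseteq> V'" using X(1) Suc.prems(2) by blast
  ultimately show ?case using X(2) by auto
qed simp

lemma card_not_color:
  assumes "finite H" "u \<in> H"
  shows "card {w \<in> H. w \<noteq> u \<and> e u w \<noteq> c} + cdeg e H u c + 1 = card H"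
proof -
  have "H - {u} = {w \<in> H. w \<noteq> u \<and> e u w \<noteq> c} \<union> {w \<in> H. w \<noteq> u \<and> e u w = c}" by auto
  then have "card (H - {u}) = card {w \<in> H. w \<noteq> u \<and> e u w \<noteq> c} + cdeg e H u c"
    unfolding cdeg_def using assms by (simp add: card_Un_disjoint disjoint_iff)
  moreover have "card H = Suc (card (H - {u}))" using assms by (rule card_Suc_Diff1[symmetric])
  ultimately show ?thesis by simp
qed

text \<open>By \<open>deg\<close> every vertex \<open>a\<close> has at least
  \<open>2 * k - 1\<close> edges whose color differs from that of \<open>va\<close>. They become its
  out-arrows, in the number that \<open>disjoint_dcycles4\<close> asks for.\<close>

lemma pack_if_vertex_in_no_pc4:
  fixes e :: "'a \<Rightarrow> 'a \<Rightarrow> 'c"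
  assumes fin: "finite H" and sym: "\<And>x y. e x y = e y x"
    and norb: "\<And>a b c. a \<in> H \<Longrightarrow> b \<in> H \<Longrightarrow> c \<in> H \<Longrightarrow> \<not> rainbow3 e a b c"
    and v: "v \<in> H" and k: "k \<ge> 1"
    and deg: "\<And>u c. u \<in> H \<Longrightarrow> cdeg e H u c + 2 * k \<le> card H"
    and nopc: "\<And>a x b. a \<in> H \<Longrightarrow> x \<in> H \<Longrightarrow> b \<in> H \<Longrightarrow> \<not> pc4 e v a x b"
  shows "pack e k H"
proof -
  define W0 where "W0 = H - {v}"
  \<comment> \<open>Here \<open>v, a, x\<close> is a properly colored path whose ends
    \<open>a\<close> and \<open>x\<close> have the same color at \<open>v\<close>; an arrow into
    \<open>x\<close> from another class would complete it to a PC cycle of length 4 through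
    \<open>v\<close>.\<close>
  define X where "X = {x \<in> W0. \<exists>a\<in>W0. a \<noteq> x \<and> e v a = e v x \<and> e a x \<noteq> e v x}"
  define W where "W = W0 - X"
  define ar where "ar a b \<longleftrightarrow> a \<noteq> b \<and> e a b \<noteq> e v a" for a b
  have W0H: "a \<in> H" "a \<noteq> v" "v \<noteq> a" if "a \<in> W0" for a using that unfolding W0_def by auto
  have WW0: "a \<in> W0" "a \<notin> X" if "a \<in> W" for a using that unfolding W_def by auto
  have two: "e a b = e v a \<or> e a b = e v b" if "a \<in> W0" "b \<in> W0" "e v a \<noteq> e v b" for a b
  proof -
    have "a \<noteq> b" using that by blast
    then show ?thesis
      using norb[of v a b] v W0H[OF that(1)] W0H[OF that(2)] that(3) sym[of b v]
      unfolding rainbow3_def by auto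
  qed
  have X_out: "e b x = e v b" if xX: "x \<in> X" and bw: "b \<in> W0" "e v b \<noteq> e v x" for x b
  proof (rule ccontr)
    assume ne: "e b x \<noteq> e v b"
    obtain a where a: "a \<in> W0" "a \<noteq> x" "e v a = e v x" "e a x \<noteq> e v x" and x: "x \<in> W0"
      using xX unfolding X_def by blast
    have bx: "e b x = e v x" using two[OF bw(1) x] bw(2) ne by blast
    have "distinct [v, a, x, b]" using a x bw W0H by auto
    then have "pc4 e v a x b"
      using a bx bw(2) sym[of x b] sym[of b v] unfolding pc4_def by simp
    then show False using nopc W0H a(1) x bw(1) by blast
  qed
  have same: "e a b = e v b" if "a \<in> W" "b \<in> W" "a \<noteq> b" "e v a = e v b" for a b
    using WW0[OF that(1)] WW0[OF that(2)] that(3,4) unfolding X_def by blast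
  \<comment> \<open>An arrow has the color of its head at \<open>v\<close>. Hence directed triangles
    are rainbow and directed 4-cycles are properly colored.\<close>
  have ar_iff: "e v a \<noteq> e v b \<and> e a b = e v b" if "a \<in> W" "b \<in> W" "ar a b" for a b
  proof -
    have "e v a \<noteq> e v b" using same[of a b] that unfolding ar_def by auto
    then show ?thesis using two[of a b] WW0 that unfolding ar_def by blast
  qed
  interpret T: tf_multipartite_tournament W "e v" ar
  proof
    show "finite W" using fin unfolding W_def W0_def by simp
  next
    fix a b assume ab: "a \<in> W" "b \<in> W" "ar a b"
    then show "e v a \<noteq> e v b" using ar_iff by blast
    show "\<not> ar b a" using ar_iff[OF ab] sym[of a b] unfolding ar_def by simp
  next
    fix a b assume ab: "a \<in> W" "b \<in> W" "e v a \<noteq> e v b"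
    then show "ar a b \<or> ar b a"
      using two[of a b] WW0 sym[of a b] unfolding ar_def by metis
  next
    fix a b d assume abd: "a \<in> W" "b \<in> W" "d \<in> W" "ar a b" "ar b d" "ar d a"
    have "rainbow3 e a b d"
      using ar_iff[OF abd(1,2,4)] ar_iff[OF abd(2,3,5)] ar_iff[OF abd(3,1,6)] abd(4-6)
      unfolding rainbow3_def ar_def by auto
    then show False using norb abd(1-3) WW0 W0H by blast
  qed
  \<comment> \<open>By \<open>deg\<close> more than one color occurs at \<open>v\<close>. An edge
    between two vertices of \<open>X\<close> in different classes would need both of their
    colors.\<close>
  have "W \<noteq> {}"
  proof
    assume "W = {}"
    then have WX: "W0 \<subseteq> X" unfolding W_def by blast
    have other: "\<exists>y\<in>W0. e v y \<noteq> c" for c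
    proof -
      have "card {w \<in> H. w \<noteq> v \<and> e v w \<noteq> c} \<noteq> 0"
        using card_not_color[OF fin v, of e c] deg[OF v, of c] k by linarith
      then have "{w \<in> H. w \<noteq> v \<and> e v w \<noteq> c} \<noteq> {}" by (metis card.empty)
      then show ?thesis unfolding W0_def by blast
    qed
    obtain x where x: "x \<in> W0" using other by blast
    obtain y where y: "y \<in> W0" "e v y \<noteq> e v x" using other by blast
    have "x \<in> X" "y \<in> X" using x y WX by blast+
    then show False using X_out[of x y] X_out[of y x] x y sym[of x y] by metis
  qed
  moreover have "2 * k \<le> card (T.outs W a) + 1" if a: "a \<in> W" for a
  proof -
    have a0: "a \<in> W0" "a \<notin> X" "a \<in> H" using WW0 W0H a by blast+
    \<comment> \<open>Restricting to \<open>W\<close> loses no out-arrow: none goes from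
      \<open>W\<close> to \<open>X\<close>, and the edge to \<open>v\<close> has the reference color
      itself.\<close>
    have "{w \<in> H. w \<noteq> a \<and> e a w \<noteq> e v a} \<subseteq> T.outs W a"
    proof
      fix w assume "w \<in> {w \<in> H. w \<noteq> a \<and> e a w \<noteq> e v a}"
      then have w: "w \<in> H" "w \<noteq> a" "e a w \<noteq> e v a" by auto
      then have w0: "w \<in> W0" using sym[of a v] unfolding W0_def by auto
      have "w \<notin> X"
      proof
        assume wX: "w \<in> X"
        have "e v a = e v w" using X_out[OF wX a0(1)] w(3) by blast
        then have "a \<in> X" unfolding X_def using a0(1) w0 w(2,3) sym[of a w] by auto
        then show False using a0 by blast
      qed
      then show "w \<in> T.outs W a"
        using w w0 unfolding T.outs_def W_def ar_def by auto
    qed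
    then have "card {w \<in> H. w \<noteq> a \<and> e a w \<noteq> e v a} \<le> card (T.outs W a)"
      using T.fin by (intro card_mono) (auto simp: T.outs_def)
    then show ?thesis using card_not_color[OF fin a0(3), of e "e v a"] deg[OF a0(3), of "e v a"] by linarith
  qed
  ultimately have dp: "T.dpack k W" using T.disjoint_dcycles4 k by blast
  have "pack e l Q" if "T.dpack l Q" "Q \<subseteq> W" for l Q
    using that
  proof (induction l arbitrary: Q)
    case (Suc l)
    then obtain a b c d where *: "a \<in> Q" "b \<in> Q" "c \<in> Q" "d \<in> Q" "T.dcycle4 a b c d"
      "T.dpack l (Q - {a, b, c, d})" by auto
    have mem: "a \<in> W" "b \<in> W" "c \<in> W" "d \<in> W" using * Suc.prems by auto
    have cyc: "ar a b" "ar b c" "ar c d" "ar d a" "a \<noteq> c" "b \<noteq> d"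
      using *(5) unfolding T.dcycle4_def by auto
    have "pc4 e a b c d"
      using ar_iff[OF mem(1,2) cyc(1)] ar_iff[OF mem(2,3) cyc(2)] ar_iff[OF mem(3,4) cyc(3)]
        ar_iff[OF mem(4,1) cyc(4)] cyc(5,6)
      unfolding pc4_def by auto
    then have "short_pc_set e {a, b, c, d}" unfolding short_pc_set_def pc4_set_def by blast
    moreover have "pack e l (Q - {a, b, c, d})" using Suc.IH *(6) Suc.prems by blast
    moreover have "{a, b, c, d} \<subseteq> Q" using * by blast
    ultimately show ?case by (intro pack_SucI)
  qed simp
  then have "pack e k W" using dp by blast
  then show ?thesis by (rule pack_mono) (auto simp: W_def W0_def)
qed

text \<open>Two colors admit no rainbow triangle, so without an alternating 4-cycle the packing
  lemma for \<open>k = 1\<close> can fail only in its degree hypothesis, which means that all edges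
  at some vertex have one color.\<close>

lemma ex_mono_vertex:
  fixes e :: "'a \<Rightarrow> 'a \<Rightarrow> bool"
  assumes "finite M" "M \<noteq> {}" "\<And>x y. e x y = e y x" "\<And>X. X \<subseteq> M \<Longrightarrow> \<not> pc4_set e X"
  obtains u c where "u \<in> M" "\<And>w. w \<in> M \<Longrightarrow> w \<noteq> u \<Longrightarrow> e u w = c"
proof -
  have norb: "\<not> rainbow3 e a b c" for a b c unfolding rainbow3_def by auto
  have "\<exists>u c. u \<in> M \<and> \<not> cdeg e M u c + 2 * 1 \<le> card M"
  proof (rule ccontr)
    assume "\<not> ?thesis"
    then have deg: "cdeg e M u c + 2 * 1 \<le> card M" if "u \<in> M" for u c using that by blast
    obtain v where v: "v \<in> M" using assms(2) by blast
    have nopc: "\<not> pc4 e v a x b" if "a \<in> M" "x \<in> M" "b \<in> M" for a x b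
    proof
      assume "pc4 e v a x b"
      then have "pc4_set e {v, a, x, b}" unfolding pc4_set_def by blast
      then show False using assms(4)[of "{v, a, x, b}"] that v by blast
    qed
    have "pack e (Suc 0) M"
      using pack_if_vertex_in_no_pc4[of M e v 1] assms(1,3) norb v deg nopc by simp
    then obtain X where "X \<subseteq> M" "short_pc_set e X" by auto
    then show False using assms(4) norb unfolding short_pc_set_def rainbow3_set_def by blast
  qed
  then obtain u c where u: "u \<in> M" "\<not> cdeg e M u c + 2 * 1 \<le> card M" by blast
  then have "card {w \<in> M. w \<noteq> u \<and> e u w \<noteq> c} = 0"
    using card_not_color[OF assms(1) u(1), of e c] by linarith
  then have "{w \<in> M. w \<noteq> u \<and> e u w \<noteq> c} = {}" using assms(1) by simp
  then show thesis using that[OF u(1), of c] by blast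
qed

section \<open>Gallai partitions\<close>

definition color_rel :: "('a \<Rightarrow> 'a \<Rightarrow> 'c) \<Rightarrow> 'c set \<Rightarrow> 'a set \<Rightarrow> ('a \<times> 'a) set" where
  "color_rel e D R = {(x, y). x \<in> R \<and> y \<in> R \<and> x \<noteq> y \<and> e x y \<in> D}"

text \<open>Cuts instead of paths: a cut of a set of representatives lifts directly to a cut of
  \<open>V\<close>.\<close>

definition color_connected :: "('a \<Rightarrow> 'a \<Rightarrow> 'c) \<Rightarrow> 'c set \<Rightarrow> 'a set \<Rightarrow> bool" where
  "color_connected e D R \<longleftrightarrow> (\<forall>X. X \<noteq> {} \<and> X \<subset> R \<longrightarrow> (\<exists>x\<in>X. \<exists>y\<in>R - X. e x y \<in> D))"

lemma color_connectedE:
  assumes "color_connected e D R" "X \<noteq> {}" "X \<subset> R"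
  obtains x y where "x \<in> X" "y \<in> R - X" "e x y \<in> D"
  using assms unfolding color_connected_def by blast

locale gallai_coloring =
  fixes V :: "'a set" and e :: "'a \<Rightarrow> 'a \<Rightarrow> 'c"
  assumes finV: "finite V" and sym: "e x y = e y x"
    and norb: "a \<in> V \<Longrightarrow> b \<in> V \<Longrightarrow> c \<in> V \<Longrightarrow> \<not> rainbow3 e a b c"
begin

lemma norb_cases:
  assumes "a \<in> V" "b \<in> V" "c \<in> V" "a \<noteq> b" "b \<noteq> c" "a \<noteq> c"
  shows "e a b = e b c \<or> e b c = e a c \<or> e a c = e a b"
  using norb[OF assms(1-3)] assms(4-6) sym[of c a] unfolding rainbow3_def by auto

abbreviation comp :: "'c set \<Rightarrow> 'a set \<Rightarrow> 'a \<Rightarrow> 'a \<Rightarrow> bool" where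
  "comp D R x y \<equiv> (x, y) \<in> (color_rel e D R)\<^sup>*"

lemma comp_sym: "comp D R x y \<Longrightarrow> comp D R y x"
proof -
  have "Relation.sym (color_rel e D R)"
    unfolding color_rel_def by (rule symI) (auto simp: sym)
  then show "comp D R x y \<Longrightarrow> comp D R y x" by (meson sym_rtrancl symE)
qed

lemma comp_trans: "comp D R x y \<Longrightarrow> comp D R y z \<Longrightarrow> comp D R x z"
  by (rule rtrancl_trans)

lemma comp_edge: "x \<in> R \<Longrightarrow> y \<in> R \<Longrightarrow> x \<noteq> y \<Longrightarrow> e x y \<in> D \<Longrightarrow> comp D R x y"
  unfolding color_rel_def by auto

lemma comp_mem: "comp D R x y \<Longrightarrow> x \<in> R \<Longrightarrow> y \<in> R"
  by (induction rule: rtrancl_induct) (auto simp: color_rel_def)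

text \<open>Along an edge \<open>yy'\<close> of the component, \<open>zy\<close> and
  \<open>zy'\<close> have colors outside \<open>D\<close> and \<open>yy'\<close> one inside, so in a
  triangle that is not rainbow \<open>zy\<close> and \<open>zy'\<close> agree.\<close>

lemma comp_module:
  assumes "R \<subseteq> V" "x \<in> R" "z \<in> R" "comp D R x y" "\<not> comp D R x z"
  shows "e z y = e z x"
  using assms(4)
proof (induction rule: rtrancl_induct)
  case (step y y')
  have m: "y \<in> R" "y' \<in> R" "y \<noteq> y'" "e y y' \<in> D" using step(2) unfolding color_rel_def by auto
  have c: "comp D R x y" "comp D R x y'" using step(1,2) by auto
  have ne: "z \<noteq> y" "z \<noteq> y'" using c assms(5) by auto
  have outside: "e u z \<notin> D" if "u \<in> R" "z \<noteq> u" "comp D R x u" for u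
  proof
    assume "e u z \<in> D"
    then have "comp D R u z" using that assms(3) by (intro comp_edge) auto
    then have "comp D R x z" by (rule comp_trans[OF that(3)])
    then show False using assms(5) by blast
  qed
  have "e y z \<notin> D" "e y' z \<notin> D"
    using outside[OF m(1) ne(1) c(1)] outside[OF m(2) ne(2) c(2)] .
  moreover have "z \<in> V" "y \<in> V" "y' \<in> V" using m assms(1,3) by blast+
  ultimately have "e z y = e z y'"
    using norb_cases[of z y y'] m(3,4) ne sym[of z y] sym[of z y'] by metis
  then show ?case using step.IH by simp
qed simp

lemma not_connected_comp:
  assumes "\<not> color_connected e D R"
  obtains a b where "a \<in> R" "b \<in> R" "\<not> comp D R a b"
proof -
  obtain X where X: "X \<noteq> {}" "X \<subset> R" "\<forall>x\<in>X. \<forall>y\<in>R - X. e x y \<notin> D"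
    using assms unfolding color_connected_def by blast
  obtain a b where ab: "a \<in> X" "b \<in> R - X" using X by blast
  have "y \<in> X" if "comp D R a y" for y using that
    by (induction rule: rtrancl_induct) (use X(3) ab(1) in \<open>auto simp: color_rel_def\<close>)
  then show thesis using that[of a b] ab X(2) by blast
qed

text \<open>If deleting \<open>v\<close> disconnected color \<open>c\<close>, every
  \<open>c\<close>-component of the rest would contain a \<open>c\<close>-neighbour of
  \<open>v\<close>. Comparing these with a \<open>c'\<close>-neighbour and a
  \<open>c''\<close>-neighbour of \<open>v\<close> forces both colors on edges that must agree by
  \<open>comp_module\<close>.\<close>

lemma not_all_connected_step:
  assumes R: "R \<subseteq> V" "v \<in> R" and dist: "c \<noteq> c'" "c \<noteq> c''" "c' \<noteq> c''"
    and conn: "color_connected e {c} R" "color_connected e {c'} R" "color_connected e {c''} R"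
    and nc: "\<not> color_connected e {c} (R - {v})"
  shows False
proof -
  let ?R = "R - {v}"
  let ?K = "comp {c} ?R"
  obtain a b where ab: "a \<in> ?R" "b \<in> ?R" "\<not> ?K a b" using not_connected_comp[OF nc] by blast
  have reach: "\<exists>y\<in>?R. ?K w y \<and> e v y = c" if w: "w \<in> ?R" for w
  proof -
    let ?Y = "{y \<in> ?R. ?K w y}"
    have "w \<in> ?Y" "v \<notin> ?Y" using w by auto
    then have Y: "?Y \<noteq> {}" "?Y \<subset> R" using R(2) by blast+
    obtain y z where yz: "y \<in> ?Y" "z \<in> R - ?Y" "e y z \<in> {c}"
      by (rule color_connectedE[OF conn(1) Y])
    have "z = v"
    proof (rule ccontr)
      assume "z \<noteq> v"
      then have zR: "z \<in> ?R" "y \<in> ?R" "y \<noteq> z" "?K w y" using yz by auto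
      then have "?K y z" using yz(3) by (intro comp_edge) auto
      then have "?K w z" using zR(4) comp_trans by blast
      then show False using yz(2) zR(1) by blast
    qed
    then show ?thesis using yz(1,3) sym[of y v] by auto
  qed
  have at_v: "\<exists>x\<in>?R. e v x = d" if dc: "color_connected e {d} R" for d
  proof -
    have "{v} \<noteq> {}" "{v} \<subset> R" using R ab by auto
    then obtain x y where "x \<in> {v}" "y \<in> R - {v}" "e x y \<in> {d}" by (rule color_connectedE[OF dc])
    then show ?thesis by auto
  qed
  obtain x where x: "x \<in> ?R" "e v x = c'" using at_v conn(2) by blast
  obtain z where z: "z \<in> ?R" "e v z = c''" using at_v conn(3) by blast
  \<comment> \<open>In the triangle \<open>v, s, y\<close> only \<open>vy\<close> has color
    \<open>c\<close>, so the other two edges agree.\<close>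
  have key: "e s y = e v s" if "s \<in> ?R" "y \<in> ?R" "e v s \<noteq> c" "\<not> ?K s y" "e v y = c" for s y
  proof -
    have ne: "s \<noteq> y" using that(4) by blast
    then have "e s y \<noteq> c" using comp_edge[of s ?R y "{c}"] that by blast
    moreover have "v \<in> V" "s \<in> V" "y \<in> V" "v \<noteq> s" "v \<noteq> y" using R that(1,2) by auto
    ultimately show ?thesis using norb_cases[of v s y] that(3,5) ne by auto
  qed
  have RV: "?R \<subseteq> V" using R by blast
  show False
  proof (cases "?K x z")
    case True
    obtain w where w: "w \<in> ?R" "\<not> ?K x w"
      using ab comp_sym[of x a] comp_trans[of a x] by blast
    obtain y where y: "y \<in> ?R" "?K w y" "e v y = c" using reach w by blast
    have nxy: "\<not> ?K x y" using w(2) comp_sym[OF y(2)] comp_trans by blast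
    then have nzy: "\<not> ?K z y" using True comp_trans by blast
    have "e x y = c'" using key[of x y] x y nxy dist by auto
    moreover have "e z y = c''" using key[of z y] z y nzy dist by auto
    moreover have "e y z = e y x" using comp_module[OF RV x(1) y(1) True nxy] .
    ultimately show False using sym dist by metis
  next
    case False
    have nzx: "\<not> ?K z x" using False comp_sym by blast
    obtain y where y: "y \<in> ?R" "?K z y" "e v y = c" using reach z by blast
    obtain y' where y': "y' \<in> ?R" "?K x y'" "e v y' = c" using reach x by blast
    have "\<not> ?K x y" using False comp_sym[OF y(2)] comp_trans by blast
    then have "e x y = c'" using key[of x y] x y dist by auto
    moreover have "\<not> ?K z y'" using nzx comp_sym[OF y'(2)] comp_trans by blast
    then have "e z y' = c''" using key[of z y'] z y' dist by auto
    moreover have "e x y = e x z" using comp_module[OF RV z(1) x(1) y(2) nzx] .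
    moreover have "e z y' = e z x" using comp_module[OF RV x(1) z(1) y'(2) False] .
    ultimately show False using sym dist by metis
  qed
qed

text \<open>This is the core of Gallai's theorem. Deleting vertices one by one keeps all three
  colors connected until two vertices remain, whose single edge has only one color.\<close>

lemma not_all_connected:
  assumes "R \<subseteq> V" "card R \<ge> 2" and dist: "p \<noteq> q" "p \<noteq> r" "q \<noteq> r"
    and "color_connected e {p} R" "color_connected e {q} R" "color_connected e {r} R"
  shows False
  using assms
proof (induction "card R" arbitrary: R rule: less_induct)
  case less
  have finR: "finite R" using less.prems(1) finV finite_subset by blast
  obtain v where v: "v \<in> R" using less.prems(2) by fastforce
  have cR: "card (R - {v}) = card R - 1" using v finR by simp
  show False
  proof (cases "card R = 2")
    case True
    then obtain w where w: "R - {v} = {w}" using cR by (metis card_1_singletonE diff_add_inverse2 one_add_one)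
    have v1: "{v} \<noteq> {}" "{v} \<subset> R" using v w by auto
    have "e v w = c" if c: "color_connected e {c} R" for c
    proof -
      obtain x y where "x \<in> {v}" "y \<in> R - {v}" "e x y \<in> {c}" by (rule color_connectedE[OF c v1])
      then show ?thesis using w by auto
    qed
    then have "e v w = p" "e v w = q" using less.prems(6,7) by blast+
    then show False using dist by blast
  next
    case False
    then have c: "card (R - {v}) \<ge> 2" "card (R - {v}) < card R" using cR less.prems(2) by auto
    have "\<not> (color_connected e {p} (R - {v}) \<and> color_connected e {q} (R - {v}) \<and> color_connected e {r} (R - {v}))"
      using less.hyps[OF c(2) _ c(1) dist] less.prems(1) by blast
    moreover have "q \<noteq> p" "r \<noteq> p" "r \<noteq> q" using dist by auto
    ultimately show False
      using not_all_connected_step[OF less.prems(1) v] dist less.prems(6-8) by metis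
  qed
qed

text \<open>The parts are the components of a maximal color set \<open>D\<close> that does not
  connect \<open>V\<close>. Edges between parts avoid \<open>D\<close>, and by maximality each color
  outside \<open>D\<close> connects the parts, so \<open>not_all_connected\<close> allows at most
  two such colors.\<close>

lemma gallai_partition_aux:
  assumes V2: "card V \<ge> 2"
  obtains P :: "'a \<Rightarrow> 'a set" and C where "finite C" "card C \<le> 2"
    "\<exists>x\<in>V. \<exists>y\<in>V. P x \<noteq> P y"
    "\<And>x y. x \<in> V \<Longrightarrow> y \<in> V \<Longrightarrow> P x \<noteq> P y \<Longrightarrow> e x y \<in> C"
    "\<And>x y z. x \<in> V \<Longrightarrow> y \<in> V \<Longrightarrow> z \<in> V \<Longrightarrow> P x = P y \<Longrightarrow> P z \<noteq> P x \<Longrightarrow> e z x = e z y"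
proof -
  let ?Col = "(\<lambda>(x, y). e x y) ` (V \<times> V)"
  let ?S = "{D. D \<subseteq> ?Col \<and> \<not> color_connected e D V}"
  have finCol: "finite ?Col" using finV by simp
  then have finS: "finite ?S" by simp
  have "\<not> color_connected e {} V"
  proof -
    obtain a b where ab: "a \<in> V" "b \<in> V" "a \<noteq> b"
      using V2 finV by (metis One_nat_def Suc_1 card_le_Suc0_iff_eq not_less_eq_eq)
    then have "{a} \<noteq> {}" "{a} \<subset> V" by auto
    then show ?thesis unfolding color_connected_def by blast
  qed
  then have "{} \<in> ?S" by simp
  then obtain D where D: "D \<in> ?S" and Dmax: "\<forall>E\<in>?S. D \<subseteq> E \<longrightarrow> D = E"
    using finite_has_maximal[OF finS] by (metis (no_types, lifting) empty_iff)
  have maxc: "color_connected e (insert p D) V" if "p \<in> ?Col - D" for p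
  proof (rule ccontr)
    assume "\<not> ?thesis"
    then have "insert p D \<in> ?S" using that D by blast
    then show False using Dmax that by blast
  qed
  define K where "K = comp D V"
  define P where "P x = {y. K x y}" for x
  have K_refl: "K x x" for x unfolding K_def by simp
  have K_sym: "K x y \<Longrightarrow> K y x" for x y unfolding K_def by (rule comp_sym)
  have K_trans: "K x y \<Longrightarrow> K y z \<Longrightarrow> K x z" for x y z unfolding K_def by (rule rtrancl_trans)
  have P_eq: "P x = P y \<longleftrightarrow> K x y" for x y
    unfolding P_def using K_refl K_sym K_trans by blast
  have K_mem: "K x y \<Longrightarrow> x \<in> V \<Longrightarrow> y \<in> V" for x y unfolding K_def by (rule comp_mem)
  have K_mod: "e z y = e z x" if "x \<in> V" "z \<in> V" "K x y" "\<not> K x z" for x y z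
    using comp_module[of V x z y D] that unfolding K_def by simp
  have K_edge: "e x y \<notin> D" if "x \<in> V" "y \<in> V" "\<not> K x y" for x y
    using comp_edge[of x V y D] that K_refl unfolding K_def by blast
  obtain a b where ab: "a \<in> V" "b \<in> V" "\<not> K a b"
    using not_connected_comp[of D V] D unfolding K_def by blast
  have "card (?Col - D) \<le> 2"
  proof (rule ccontr)
    assume "\<not> ?thesis"
    then have "3 \<le> card (?Col - D)" by simp
    then obtain T where T: "T \<subseteq> ?Col - D" "card T = 3" by (rule obtain_subset_with_card_n)
    then obtain p q r where pqr: "T = {p, q, r}" "p \<noteq> q" "q \<noteq> r" "p \<noteq> r"
      unfolding card_3_iff by blast
    \<comment> \<open>A representative of each part. As any two parts see each other in one color,
      an edge between parts can be moved to their representatives.\<close>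
    define f where "f S = (SOME y::'a. y \<in> S)" for S
    have f: "K x (f (P x))" for x
      using someI[of "\<lambda>y. y \<in> P x" x] K_refl unfolding f_def P_def by simp
    then have Pf: "P (f (P x)) = P x" for x using P_eq K_sym by blast
    define R where "R = (\<lambda>x. f (P x)) ` V"
    have RV: "R \<subseteq> V" using f K_mem unfolding R_def by blast
    have fR: "f (P s) = s" if "s \<in> R" for s using that Pf unfolding R_def by auto
    have "{f (P a), f (P b)} \<subseteq> R" using ab unfolding R_def by blast
    moreover have "f (P a) \<noteq> f (P b)" using ab Pf P_eq by metis
    then have "card {f (P a), f (P b)} = 2" by simp
    ultimately have R2: "card R \<ge> 2" by (metis RV card_mono finV finite_subset)
    have conn: "color_connected e {s} R" if s: "s \<in> T" for s
      unfolding color_connected_def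
    proof (intro allI impI)
      fix X assume X: "X \<noteq> {} \<and> X \<subset> R"
      let ?X = "{x \<in> V. f (P x) \<in> X}"
      obtain x0 where "x0 \<in> X" using X by blast
      then have "x0 \<in> ?X" using X RV fR by auto
      moreover obtain y0 where "y0 \<in> R - X" using X by blast
      then have "y0 \<in> V - ?X" using RV fR by auto
      ultimately have XV: "?X \<noteq> {}" "?X \<subset> V" by blast+
      have "color_connected e (insert s D) V" using maxc s T by blast
      then obtain x y where xy: "x \<in> ?X" "y \<in> V - ?X" "e x y \<in> insert s D"
        using XV by (rule color_connectedE)
      have V: "x \<in> V" "y \<in> V" "f (P x) \<in> V" "f (P y) \<in> V" using xy f K_mem by blast+
      have "f (P x) \<noteq> f (P y)" using xy(1,2) by auto
      then have nK: "\<not> K x y" using P_eq by metis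
      then have s: "e x y = s" using K_edge V xy(3) by blast
      have nK': "\<not> K y (f (P x))" using nK f K_sym K_trans by blast
      have "e y (f (P x)) = e y x" using K_mod[of x y "f (P x)"] V f nK by blast
      moreover have "e (f (P x)) (f (P y)) = e (f (P x)) y"
        using K_mod[of y "f (P x)" "f (P y)"] V f nK' by blast
      ultimately have "e (f (P x)) (f (P y)) = s" using s sym by metis
      moreover have "f (P x) \<in> X" "f (P y) \<in> R - X" using xy V unfolding R_def by auto
      ultimately show "\<exists>x\<in>X. \<exists>y\<in>R - X. e x y \<in> {s}" by blast
    qed
    show False
      using not_all_connected[OF RV R2 pqr(2) pqr(4) pqr(3)] conn pqr(1) by blast
  qed
  moreover have "finite (?Col - D)" using finCol by simp
  moreover have "\<exists>x\<in>V. \<exists>y\<in>V. P x \<noteq> P y" using ab P_eq by blast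
  moreover have "e x y \<in> ?Col - D" if "x \<in> V" "y \<in> V" "P x \<noteq> P y" for x y
    using that K_edge P_eq by auto
  moreover have "e z x = e z y" if "x \<in> V" "y \<in> V" "z \<in> V" "P x = P y" "P z \<noteq> P x" for x y z
    using K_mod[of y z x] that P_eq by metis
  ultimately show thesis using that by blast
qed

end

text \<open>Padding: two distinct names are available even if fewer colors occur between the
  parts.\<close>

lemma card_le_2_subset_doubleton:
  fixes C :: "nat set"
  assumes "finite C" "card C \<le> 2"
  obtains q r where "q \<noteq> r" "C \<subseteq> {q, r}"
proof -
  consider "card C = 0" | "card C = 1" | "card C = 2" using assms(2) by linarith
  then show thesis
  proof cases
    case 1
    then show thesis using that[of 0 1] assms by simp
  next
    case 2
    then obtain a where "C = {a}" by (rule card_1_singletonE)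
    then show thesis using that[of a "Suc a"] by simp
  next
    case 3
    then show thesis using that card_2_iff[of C] by blast
  qed
qed

theorem gallai_partition:
  fixes e :: "'a \<Rightarrow> 'a \<Rightarrow> nat"
  assumes "gallai_coloring V e" "card V \<ge> 2"
  obtains P :: "'a \<Rightarrow> 'a set" and q r where "q \<noteq> r"
    "\<exists>x\<in>V. \<exists>y\<in>V. P x \<noteq> P y"
    "\<And>x y. x \<in> V \<Longrightarrow> y \<in> V \<Longrightarrow> P x \<noteq> P y \<Longrightarrow> e x y = q \<or> e x y = r"
    "\<And>x y z. x \<in> V \<Longrightarrow> y \<in> V \<Longrightarrow> z \<in> V \<Longrightarrow> P x = P y \<Longrightarrow> P z \<noteq> P x \<Longrightarrow> e z x = e z y"
proof -
  interpret gallai_coloring V e by (rule assms(1))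
  obtain P :: "'a \<Rightarrow> 'a set" and C where C: "finite C" "card C \<le> 2"
    and P: "\<exists>x\<in>V. \<exists>y\<in>V. P x \<noteq> P y"
    "\<And>x y. x \<in> V \<Longrightarrow> y \<in> V \<Longrightarrow> P x \<noteq> P y \<Longrightarrow> e x y \<in> C"
    "\<And>x y z. x \<in> V \<Longrightarrow> y \<in> V \<Longrightarrow> z \<in> V \<Longrightarrow> P x = P y \<Longrightarrow> P z \<noteq> P x \<Longrightarrow> e z x = e z y"
    by (rule gallai_partition_aux[OF assms(2)]) blast
  obtain q r where "q \<noteq> r" "C \<subseteq> {q, r}" by (rule card_le_2_subset_doubleton[OF C])
  then show thesis using that[of q r P] P by blast
qed

section \<open>Two disjoint alternating cycles in a two-coloring\<close>

lemma card_le_3: "card {a, b, c} \<le> 3"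
  by (simp add: card_insert_if)

lemma eq_4_if_card_ge:
  assumes "X \<subseteq> {a, b, c, d}" "4 \<le> card X"
  shows "X = {a, b, c, d}"
proof -
  have "card {a, b, c, d} \<le> 4" by (simp add: card_insert_if)
  then show ?thesis using assms by (intro card_seteq) auto
qed

lemma not_subset_3:
  assumes "4 \<le> card X"
  shows "\<not> X \<subseteq> {a, b, c}"
proof
  assume "X \<subseteq> {a, b, c}"
  then have "card X \<le> card {a, b, c}" by (intro card_mono) simp_all
  then show False using assms card_le_3[of a b c] by linarith
qed

text \<open>\<open>True\<close> is read as red and \<open>False\<close> as blue. The bound 4 is 3k -
  2 for k = 2.\<close>

locale two_coloring =
  fixes V :: "'a set" and e :: "'a \<Rightarrow> 'a \<Rightarrow> bool"
  assumes finV: "finite V" and sym: "e x y = e y x"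
    and deg: "v \<in> V \<Longrightarrow> 4 \<le> cdeg e V v c"
begin

definition nb :: "'a \<Rightarrow> bool \<Rightarrow> 'a set" where
  "nb v c = {w \<in> V. w \<noteq> v \<and> e v w = c}"

lemma symD: "e p q \<Longrightarrow> e q p"
  using sym[of p q] by simp

lemma mono_vertex:
  assumes "M \<subseteq> V" "M \<noteq> {}" "\<And>X. X \<subseteq> M \<Longrightarrow> \<not> pc4_set e X"
  obtains u c where "u \<in> M" "\<And>w. w \<in> M \<Longrightarrow> w \<noteq> u \<Longrightarrow> e u w = c"
  using ex_mono_vertex[of M e, OF finite_subset[OF assms(1) finV] assms(2) sym assms(3)] by blast

lemma nb_card: "v \<in> V \<Longrightarrow> 4 \<le> card (nb v c)"
  using deg unfolding cdeg_def nb_def .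

lemma nb_not3: "v \<in> V \<Longrightarrow> \<not> nb v c \<subseteq> {p, q, r}"
  by (rule not_subset_3[OF nb_card])

lemma nb_eq4: "v \<in> V \<Longrightarrow> nb v c \<subseteq> {p, q, r, s} \<Longrightarrow> nb v c = {p, q, r, s}"
  by (rule eq_4_if_card_ge[OF _ nb_card])

lemma two_pc4I:
  assumes "pc4 e a b c d" "pc4 e a' b' c' d'" "{a, b, c, d} \<subseteq> V" "{a', b', c', d'} \<subseteq> V"
    "{a, b, c, d} \<inter> {a', b', c', d'} = {}"
  shows "two_pc4 e V"
proof -
  have "pc4_set e {a, b, c, d}" "pc4_set e {a', b', c', d'}"
    using assms(1,2) unfolding pc4_set_def by blast+
  then show ?thesis
    unfolding two_pc4_def using assms(3-5) by blast
qed

end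

text \<open>Two vertices that are red to everything off an alternating cycle \<open>xyzw\<close> are blue to the cycle
  itself, since all degrees in blue are at least 4.\<close>

locale two_coloring_frame = two_coloring V e for V :: "'a set" and e +
  fixes x y z w u v :: 'a and M :: "'a set"
  assumes dist: "distinct [x, y, z, w, u, v]"
    and V_eq: "V = {x, y, z, w, u, v} \<union> M" and M_disj: "M \<inter> {x, y, z, w, u, v} = {}"
    and cyc: "e x y" "\<not> e y z" "e z w" "\<not> e w x"
    and full: "e u v" "\<And>m. m \<in> M \<Longrightarrow> e u m" "\<And>m. m \<in> M \<Longrightarrow> e v m"
    and blue: "\<And>p. p \<in> {x, y, z, w} \<Longrightarrow> \<not> e u p" "\<And>p. p \<in> {x, y, z, w} \<Longrightarrow> \<not> e v p"
    and noalt: "X \<subseteq> insert u (insert v M) \<Longrightarrow> \<not> pc4_set e X"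
begin

lemma dist_simps:
  shows "x \<noteq> y" "x \<noteq> z" "x \<noteq> w" "x \<noteq> u" "x \<noteq> v" "y \<noteq> z" "y \<noteq> w" "y \<noteq> u" "y \<noteq> v"
      "z \<noteq> w" "z \<noteq> u" "z \<noteq> v" "w \<noteq> u" "w \<noteq> v" "u \<noteq> v"
    and "y \<noteq> x" "z \<noteq> x" "w \<noteq> x" "u \<noteq> x" "v \<noteq> x" "z \<noteq> y" "w \<noteq> y" "u \<noteq> y" "v \<noteq> y"
      "w \<noteq> z" "u \<noteq> z" "v \<noteq> z" "u \<noteq> w" "v \<noteq> w" "v \<noteq> u"
proof -
  show d: "x \<noteq> y" "x \<noteq> z" "x \<noteq> w" "x \<noteq> u" "x \<noteq> v" "y \<noteq> z" "y \<noteq> w" "y \<noteq> u" "y \<noteq> v"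
      "z \<noteq> w" "z \<noteq> u" "z \<noteq> v" "w \<noteq> u" "w \<noteq> v" "u \<noteq> v"
    using dist by simp_all
  show "y \<noteq> x" "z \<noteq> x" "w \<noteq> x" "u \<noteq> x" "v \<noteq> x" "z \<noteq> y" "w \<noteq> y" "u \<noteq> y" "v \<noteq> y"
      "w \<noteq> z" "u \<noteq> z" "v \<noteq> z" "u \<noteq> w" "v \<noteq> w" "v \<noteq> u"
    by (fact d[THEN not_sym])+
qed

lemma col_simps:
  shows "e x y" "\<not> e y z" "e z w" "\<not> e w x" "e u v"
    and "\<not> e u x" "\<not> e u y" "\<not> e u z" "\<not> e u w" "\<not> e v x" "\<not> e v y" "\<not> e v z" "\<not> e v w"
    and "e y x" "\<not> e z y" "e w z" "\<not> e x w" "e v u"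
    and "\<not> e x u" "\<not> e y u" "\<not> e z u" "\<not> e w u" "\<not> e x v" "\<not> e y v" "\<not> e z v" "\<not> e w v"
proof -
  show c: "e x y" "\<not> e y z" "e z w" "\<not> e w x" "e u v" by (fact cyc full)+
  show b: "\<not> e u x" "\<not> e u y" "\<not> e u z" "\<not> e u w" "\<not> e v x" "\<not> e v y" "\<not> e v z" "\<not> e v w"
    using blue by simp_all
  show "e y x" "e w z" "e v u" by (rule symD, fact c)+
  show "\<not> e z y" "\<not> e x w" "\<not> e x u" "\<not> e y u" "\<not> e z u" "\<not> e w u" "\<not> e x v" "\<not> e y v" "\<not> e z v" "\<not> e w v"
    by (rule notI, drule symD, erule notE[rotated], fact b c)+
qed

lemma M_facts:
  assumes "m \<in> M"
  shows "m \<in> V" "m \<noteq> x" "m \<noteq> y" "m \<noteq> z" "m \<noteq> w" "m \<noteq> u" "m \<noteq> v"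
    "x \<noteq> m" "y \<noteq> m" "z \<noteq> m" "w \<noteq> m" "u \<noteq> m" "v \<noteq> m" "e u m" "e v m" "e m u" "e m v"
proof -
  show V: "m \<in> V" using assms V_eq by simp
  show "m \<noteq> x" "m \<noteq> y" "m \<noteq> z" "m \<noteq> w" "m \<noteq> u" "m \<noteq> v"
    "x \<noteq> m" "y \<noteq> m" "z \<noteq> m" "w \<noteq> m" "u \<noteq> m" "v \<noteq> m" using assms M_disj by auto
  show "e u m" "e v m" using full assms by simp_all
  show "e m u" using full(2)[OF assms] by (rule symD)
  show "e m v" using full(3)[OF assms] by (rule symD)
qed

lemma V_mem: "x \<in> V" "y \<in> V" "z \<in> V" "w \<in> V" "u \<in> V" "v \<in> V"
  using V_eq by auto

lemma nb_subset: "nb p c \<subseteq> {q. q \<in> {x, y, z, w, u, v} \<and> q \<noteq> p \<and> e p q = c} \<union> {q \<in> M. q \<noteq> p \<and> e p q = c}"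
  using V_eq unfolding nb_def by blast

lemma frame_swap: "two_coloring_frame V e z w x y u v M"
proof
  show "V = {z, w, x, y, u, v} \<union> M" using V_eq by blast
  show "M \<inter> {z, w, x, y, u, v} = {}" using M_disj by blast
  show "distinct [z, w, x, y, u, v]" by (simp add: dist_simps)
  show "e u v" "e z w" "\<not> e w x" "e x y" "\<not> e y z" by (simp_all add: col_simps)
  show "\<not> e u p" "\<not> e v p" if "p \<in> {z, w, x, y}" for p using blue that by blast+
qed (fact full noalt)+

text \<open>\<open>u x a b\<close> runs blue, red, blue, red, since \<open>u\<close> is blue to the
  cycle and red to \<open>M\<close>; likewise \<open>v y c d\<close>. So two disjoint blue edges in
  \<open>M\<close> suffice once \<open>x\<close> and \<open>y\<close> are joined to them in
  red.\<close>

lemma two_pc4_matching: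
  assumes mem: "a \<in> M" "b \<in> M" "c \<in> M" "d \<in> M" and dist: "distinct [a, b, c, d]"
    and col: "e x a" "\<not> e a b" "e y c" "\<not> e c d"
  shows "two_pc4 e V"
proof (rule two_pc4I[of u x a b v y c d])
  show "pc4 e u x a b"
    unfolding pc4_def by (simp add: M_facts mem dist_simps col_simps col dist[simplified])
  show "pc4 e v y c d"
    unfolding pc4_def by (simp add: M_facts mem dist_simps col_simps col dist[simplified])
qed (use mem dist in \<open>simp_all add: V_mem M_facts dist_simps\<close>)

text \<open>\<open>t\<close> is blue to both ends of the red edge \<open>xy\<close> and red to
  \<open>a\<close>, so a blue edge from \<open>a\<close> to either end closes an alternating
  cycle.\<close>

lemma pc4_red_edge:
  assumes mem: "a \<in> M" and t: "t \<in> {u, v}" and col: "\<not> e x a \<or> \<not> e y a"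
  shows "pc4_set e {x, y, t, a}"
proof (cases "e x a")
  case False
  then have "pc4 e x y t a" using t
    unfolding pc4_def by (auto simp add: M_facts mem dist_simps col_simps sym[of a x])
  then show ?thesis unfolding pc4_set_def by blast
next
  case True
  then have "pc4 e y x t a" using t col
    unfolding pc4_def by (auto simp add: M_facts mem dist_simps col_simps sym[of a y])
  moreover have "{x, y, t, a} = {y, x, t, a}" by blast
  ultimately show ?thesis unfolding pc4_set_def by metis
qed

text \<open>The red edges \<open>xy\<close> and \<open>zw\<close> receive different partners, both
  among \<open>u, v\<close> and in \<open>M\<close>.\<close>

lemma two_pc4_sdr:
  assumes mem: "a \<in> M" "b \<in> M" "a \<noteq> b"
    and a: "\<not> e x a \<or> \<not> e y a" and b: "\<not> e z b \<or> \<not> e w b"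
  shows "two_pc4 e V"
proof -
  interpret S: two_coloring_frame V e z w x y u v M by (rule frame_swap)
  have A: "pc4_set e {x, y, u, a}" using pc4_red_edge a mem by blast
  have B: "pc4_set e {z, w, v, b}" using S.pc4_red_edge b mem by blast
  show ?thesis unfolding two_pc4_def
    by (intro exI[of _ "{x, y, u, a}"] exI[of _ "{z, w, v, b}"] conjI A B)
      (use mem in \<open>simp_all add: V_mem M_facts dist_simps\<close>)
qed

text \<open>\<open>u\<close> is blue to the cycle, so at least three of its red neighbours lie in
  \<open>M\<close>.\<close>

lemma M_not_subset_2: "\<not> M \<subseteq> {p, q}"
proof
  assume "M \<subseteq> {p, q}"
  then have "nb u True \<subseteq> {v, p, q}" using nb_subset[of u True] col_simps by blast
  then show False using nb_not3 V_mem by blast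
qed

text \<open>Without two disjoint blue edges in \<open>M\<close>, a vertex \<open>b\<close> that is
  blue to the rest of \<open>M\<close> and a blue edge \<open>qq'\<close> exhaust \<open>M\<close>.
  With so few vertices in \<open>M\<close>, blue degree 4 makes \<open>z\<close> blue to all of
  \<open>M\<close>, and \<open>w\<close> remains as its only red neighbour.\<close>

lemma two_pc4_red_pair:
  assumes red: "\<And>m. m \<in> M \<Longrightarrow> e x m \<and> e y m"
  shows "two_pc4 e V"
proof (rule ccontr)
  assume no: "\<not> ?thesis"
  have xy: "e x m" "e y m" "e m x" "e m y" if "m \<in> M" for m using red that symD by blast+
  have noM: False if "a \<in> M" "b \<in> M" "c \<in> M" "d \<in> M" "distinct [a, b, c, d]" "\<not> e a b" "\<not> e c d" for a b c d
    using two_pc4_matching[of a b c d] that xy no by blast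
  have "nb x False \<subseteq> {u, v, z, w}"
    using nb_subset[of x False] xy col_simps by blast
  then have "nb x False = {u, v, z, w}" using nb_eq4 V_mem by blast
  then have xz: "\<not> e x z" unfolding nb_def by auto
  have MV: "M \<subseteq> V" "M \<noteq> {}" using V_eq M_not_subset_2 by blast+
  have nopc: "\<not> pc4_set e X" if "X \<subseteq> M" for X using noalt that by blast
  obtain b c where b: "b \<in> M" and bc: "\<And>m. m \<in> M \<Longrightarrow> m \<noteq> b \<Longrightarrow> e b m = c"
    using mono_vertex[OF MV nopc] by blast
  have nbM: "nb m False \<subseteq> {z, w} \<union> {q \<in> M. q \<noteq> m \<and> \<not> e m q}" if "m \<in> M" for m
    using nb_subset[of m False] xy[OF that] M_facts[OF that] by blast
  have "\<not> nb b False \<subseteq> {z, w, w}" using nb_not3 M_facts b by blast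
  then have "\<not> c" using nbM[OF b] bc by blast
  then have bF: "\<not> e b m" if "m \<in> M" "m \<noteq> b" for m using bc that by blast
  obtain q where q: "q \<in> M" "q \<noteq> b" using M_not_subset_2[of b b] by blast
  have "\<not> nb q False \<subseteq> {b, z, w}" using nb_not3 M_facts q by blast
  then obtain q' where q': "q' \<in> M" "q' \<noteq> b" "q' \<noteq> q" "\<not> e q q'"
    using nbM[OF q(1)] by blast
  have M3: "m \<in> {b, q, q'}" if "m \<in> M" for m
    using noM[of b m q q'] that b bF q q' by auto
  have zF: "\<not> e z m" if m: "m \<in> M" for m
  proof -
    have "{b, q, q'} \<subseteq> {m, q, q'} \<or> {b, q, q'} \<subseteq> {m, b, q'} \<or> {b, q, q'} \<subseteq> {m, b, q}" using M3[OF m] by blast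
    then obtain s t where st: "{b, q, q'} \<subseteq> {m, s, t}" by blast
    have "nb m False \<subseteq> {s, t, z, w}"
      using nbM[OF m] M3 st by blast
    then have "nb m False = {s, t, z, w}" using nb_eq4 M_facts m by blast
    then have "z \<in> nb m False" by blast
    then show ?thesis using symD unfolding nb_def by blast
  qed
  have "nb z True \<subseteq> {w, w, w}"
    using nb_subset[of z True] zF xz col_simps symD by blast
  then show False using nb_not3 V_mem by blast
qed

lemma two_pc4: "two_pc4 e V"
proof -
  \<comment> \<open>Hall's condition for two subsets of \<open>M\<close>: they have distinct
    representatives, or one is empty, or both lie in one singleton.\<close>
  consider (sdr) a b where "a \<in> M" "b \<in> M" "a \<noteq> b" "\<not> e x a \<or> \<not> e y a" "\<not> e z b \<or> \<not> e w b"
    | (xy) "\<forall>m\<in>M. e x m \<and> e y m" | (zw) "\<forall>m\<in>M. e z m \<and> e w m"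
    | (one) a where "\<forall>m\<in>M. m \<noteq> a \<longrightarrow> e x m \<and> e y m \<and> e z m \<and> e w m" by metis
  then show ?thesis
  proof cases
    case sdr
    then show ?thesis using two_pc4_sdr by blast
  next
    case xy
    then show ?thesis using two_pc4_red_pair by blast
  next
    case zw
    interpret S: two_coloring_frame V e z w x y u v M by (rule frame_swap)
    show ?thesis using S.two_pc4_red_pair zw by blast
  next
    case one
    have nbM: "nb m False \<subseteq> M" if "m \<in> M" "m \<noteq> a" for m
    proof -
      have "e m x" "e m y" "e m z" "e m w" using one that symD by blast+
      then show ?thesis using nb_subset[of m False] M_facts[OF that(1)] by blast
    qed
    \<comment> \<open>Only \<open>p\<close> and \<open>r\<close> have to avoid \<open>a\<close>,
      since only they need red edges to the cycle. Blue degree 4 leaves room for \<open>q\<close>,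
      \<open>r\<close> and \<open>s\<close>.\<close>
    obtain p where p: "p \<in> M" "p \<noteq> a" using M_not_subset_2[of a a] by blast
    have pV: "p \<in> V" using p M_facts by blast
    obtain q where q: "q \<in> nb p False" using nb_not3[OF pV, of False p p p] by blast
    obtain r where r: "r \<in> nb p False" "r \<noteq> a" "r \<noteq> q" using nb_not3[OF pV, of False a q q] by blast
    have rM: "r \<in> M" "r \<in> V" using nbM p r M_facts by blast+
    obtain s where s: "s \<in> nb r False" "s \<noteq> p" "s \<noteq> q" using nb_not3[OF rM(2), of False p q q] by blast
    have "q \<in> M" "s \<in> M" using nbM p q rM r s by blast+
    moreover have "distinct [p, q, r, s]" "\<not> e p q" "\<not> e r s" using q r s unfolding nb_def by auto
    moreover have "e x p" "e y r" using one p r rM by auto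
    ultimately show ?thesis using two_pc4_matching[of p q r s] p rM by blast
  qed
qed

end

context two_coloring
begin

text \<open>Monochromatic vertices off different alternating cycles are played against each other.
  Off the old cycle and \<open>u\<close> there is a vertex \<open>v\<close>, blue to the others. Off
  a new cycle through \<open>u\<close>, \<open>p\<close>, \<open>v\<close> there is a vertex
  \<open>t\<close> of the old cycle, red to the rest of that cycle except possibly \<open>p\<close>;
  a suitable \<open>p\<close> contradicts the blue cycle edge at \<open>t\<close>.\<close>

lemma red_vertex_two_pc4:
  assumes xyzw: "distinct [x, y, z, w]" "{x, y, z, w} \<subseteq> V"
      "e x y" "\<not> e y z" "e z w" "\<not> e w x"
    and u: "u \<in> V - {x, y, z, w}" and red: "\<And>m. m \<in> V - {x, y, z, w} \<Longrightarrow> m \<noteq> u \<Longrightarrow> e u m"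
  shows "two_pc4 e V"
proof (rule ccontr)
  assume no: "\<not> ?thesis"
  let ?C = "{x, y, z, w}"
  have "pc4 e x y z w" using xyzw unfolding pc4_def by simp
  then have C: "pc4_set e ?C" unfolding pc4_set_def by blast
  have noalt: "\<not> pc4_set e X" if "X \<subseteq> V - ?C" for X
    using no C that xyzw(2) unfolding two_pc4_def by blast
  have "nb u False \<subseteq> ?C" using red unfolding nb_def by auto
  then have "nb u False = ?C" using nb_eq4 u by blast
  then have uC: "\<not> e u p" if "p \<in> ?C" for p using that unfolding nb_def by blast
  \<comment> \<open>A second such vertex would complete a \<open>two_coloring_frame\<close>.\<close>
  have uniq: "v = u" if v: "v \<in> V - ?C" "\<And>m. m \<in> V - ?C \<Longrightarrow> m \<noteq> v \<Longrightarrow> e v m" for v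
  proof (rule ccontr)
    assume "v \<noteq> u"
    have "nb v False \<subseteq> ?C" using v unfolding nb_def by auto
    then have "nb v False = ?C" using nb_eq4 v by blast
    then have "\<not> e v p" if "p \<in> ?C" for p using that unfolding nb_def by blast
    note vC = this
    have "two_coloring_frame V e x y z w u v (V - {x, y, z, w, u, v})"
    proof
      show "distinct [x, y, z, w, u, v]" using xyzw(1) u v(1) \<open>v \<noteq> u\<close> by auto
      show "V = {x, y, z, w, u, v} \<union> (V - {x, y, z, w, u, v})" using xyzw(2) u v(1) by blast
      show "e u v" using red[of v] v(1) \<open>v \<noteq> u\<close> by blast
      show "e u m" "e v m" if "m \<in> V - {x, y, z, w, u, v}" for m using red[of m] v(2)[of m] that by blast+
      show "\<not> pc4_set e X" if "X \<subseteq> insert u (insert v (V - {x, y, z, w, u, v}))" for X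
        using noalt[of X] that u v(1) by blast
    qed (use xyzw(3-6) uC vC in blast)+
    from two_coloring_frame.two_pc4[OF this] no show False by blast
  qed
  define M where "M = V - ?C - {u}"
  have "\<not> nb u True \<subseteq> {u, u, u}" using nb_not3 u by blast
  then have M: "M \<subseteq> V" "M \<noteq> {}" using uC unfolding nb_def M_def by auto
  have noM: "\<not> pc4_set e X" if "X \<subseteq> M" for X using noalt[of X] that unfolding M_def by blast
  obtain v c where v: "v \<in> M" and vc: "\<And>m. m \<in> M \<Longrightarrow> m \<noteq> v \<Longrightarrow> e v m = c"
    using mono_vertex[OF M noM] by blast
  have vV: "v \<in> V" "v \<noteq> u" "v \<notin> ?C" using v M_def by auto
  have uv: "e u v" "e v u" using red[of v] symD[of u v] v unfolding M_def by auto
  have "\<not> c"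
  proof
    assume c
    then have "e v m" if "m \<in> V - ?C" "m \<noteq> v" for m
      using that vc[of m] uv unfolding M_def by auto
    then show False using uniq[of v] vV by blast
  qed
  then have vF: "\<not> e v m" if "m \<in> M" "m \<noteq> v" for m using vc that by blast
  have nbv: "nb v True \<subseteq> insert u {p \<in> ?C. e v p}" using vF unfolding nb_def M_def by auto
  \<comment> \<open>\<open>v\<close> has at least four red neighbours, and all but \<open>u\<close>
    lie on the cycle.\<close>
  have one_blue: "p = q" if "p \<in> ?C" "q \<in> ?C" "\<not> e v p" "\<not> e v q" for p q
  proof (rule ccontr)
    assume "p \<noteq> q"
    then have "card (?C - {p, q}) = card ?C - 2"
      using that card_Diff_subset[of "{p, q}" ?C] by simp
    moreover have "card ?C \<le> 4" by (simp add: card_insert_if)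
    moreover have ins: "card (insert u X) \<le> Suc (card X)" if "finite X" for X
      using that by (simp add: card_insert_if)
    have "card (insert u (?C - {p, q})) \<le> Suc (card (?C - {p, q}))" by (rule ins) simp
    ultimately have "card (insert u (?C - {p, q})) \<le> 3" by linarith
    moreover have "nb v True \<subseteq> insert u (?C - {p, q})" using nbv that(3,4) by blast
    then have "card (nb v True) \<le> card (insert u (?C - {p, q}))" by (intro card_mono) simp_all
    ultimately show False using nb_card[OF vV(1), of True] by linarith
  qed
  obtain m where m: "m \<in> M" "m \<noteq> v"
  proof -
    have "\<not> nb u True \<subseteq> {v, v, v}" using nb_not3 u by blast
    then show thesis using that uC unfolding nb_def M_def by blast
  qed
  have key: "\<exists>t\<in>?C. t \<noteq> p \<and> \<not> e v t \<and> (\<forall>s\<in>?C. s \<noteq> p \<and> s \<noteq> t \<longrightarrow> e t s)"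
    if p: "p \<in> ?C" "e v p" for p
  proof -
    \<comment> \<open>The new cycle: \<open>up\<close> is blue, \<open>pv\<close> red,
      \<open>vm\<close> blue and \<open>mu\<close> red.\<close>
    let ?D = "{u, p, v, m}"
    have "pc4 e u p v m" unfolding pc4_def
      using uC[OF p(1)] p(2) sym[of p v] vF[OF m] red[of m] sym[of m u] m u p vV
      unfolding M_def by auto
    then have D: "pc4_set e ?D" unfolding pc4_set_def by blast
    have DV: "?D \<subseteq> V" using u p xyzw vV m unfolding M_def by auto
    have noD: "\<not> pc4_set e X" if "X \<subseteq> V - ?D" for X
      using no D DV that unfolding two_pc4_def by blast
    have mC: "m \<in> V" "m \<notin> ?C" using m unfolding M_def by blast+
    have "?C - {p} \<noteq> {}" using xyzw(1) by auto
    then obtain s where "s \<in> ?C" "s \<noteq> p" by blast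
    then have "s \<in> V - ?D" using u vV mC xyzw(2) by blast
    then have ne: "V - ?D \<noteq> {}" by blast
    obtain t c' where t: "t \<in> V - ?D" and tc: "\<And>s. s \<in> V - ?D \<Longrightarrow> s \<noteq> t \<Longrightarrow> e t s = c'"
      using mono_vertex[OF Diff_subset ne noD] by blast
    have "nb t (\<not> c') \<subseteq> {u, p, v, m}" using tc unfolding nb_def by auto
    then have "nb t (\<not> c') = {u, p, v, m}" using nb_eq4 t by blast
    then have tu: "e t u = (\<not> c')" and tv: "e t v = (\<not> c')" unfolding nb_def by auto
    have tC: "t \<in> ?C"
    proof (rule ccontr)
      assume "t \<notin> ?C"
      then have "t \<in> M" "t \<noteq> v" "e t u" using t red[of t] sym[of t u] unfolding M_def by auto
      then show False using tu tv vF[of t] symD[of t v] by blast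
    qed
    then have "\<not> e t u" using uC symD by blast
    then have c': c' using tu by blast
    have "e t s" if "s \<in> ?C" "s \<noteq> p" "s \<noteq> t" for s
      using tc[of s] c' that u vV mC xyzw(2) by blast
    moreover have "\<not> e v t" using tv c' symD by blast
    ultimately show ?thesis using tC t by blast
  qed
  obtain t where t: "t \<in> ?C" "\<not> e v t"
    using key[of x] xyzw by (cases "e v x") auto
  \<comment> \<open>\<open>q\<close> is a blue neighbour of \<open>t\<close> on the alternating
    cycle. With \<open>p\<close> chosen apart from both, \<open>key\<close> makes \<open>tq\<close>
    red.\<close>
  obtain p q where pq: "p \<in> ?C" "q \<in> ?C" "p \<noteq> t" "q \<noteq> t" "p \<noteq> q" "\<not> e t q"
    using t xyzw symD by auto
  have "e v p" using one_blue[of p t] pq t by blast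
  then obtain t' where t': "t' \<in> ?C" "\<not> e v t'" "\<forall>s\<in>?C. s \<noteq> p \<and> s \<noteq> t' \<longrightarrow> e t' s" using key pq by blast
  have "t' = t" using one_blue t t' by blast
  then have "e t q" using bspec[OF t'(3) pq(2)] pq(4,5) by blast
  then show False using pq by simp
qed

end

lemma two_pc4_complement: "two_pc4 (\<lambda>x y. \<not> e x y) V \<longleftrightarrow> two_pc4 e V"
  unfolding two_pc4_def pc4_set_def pc4_def by simp

text \<open>Off an alternating cycle there is a monochromatic vertex. If it is blue, complementing
  the colors and rotating the cycle by one position gives the red case.\<close>

lemma (in two_coloring) two_pc4:
  assumes "V \<noteq> {}"
  shows "two_pc4 e V"
proof -
  have ex: "\<exists>X\<subseteq>V. pc4_set e X"
  proof (rule ccontr)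
    assume "\<not> ?thesis"
    then have "\<not> pc4_set e X" if "X \<subseteq> V" for X using that by blast
    from mono_vertex[OF subset_refl assms this]
    obtain u c where "u \<in> V" "\<And>w. w \<in> V \<Longrightarrow> w \<noteq> u \<Longrightarrow> e u w = c" by blast
    then have "u \<in> V" "nb u (\<not> c) \<subseteq> {u, u, u}" unfolding nb_def by auto
    then show False using nb_not3 by blast
  qed
  then obtain a b c d where abcd: "{a, b, c, d} \<subseteq> V" "pc4 e a b c d" unfolding pc4_set_def by blast
  obtain x y z w where xyzw: "{x, y, z, w} = {a, b, c, d}" "distinct [x, y, z, w]"
    "e x y" "\<not> e y z" "e z w" "\<not> e w x"
  proof (cases "e a b")
    case True
    then show thesis using that[of a b c d] abcd(2) unfolding pc4_def by auto
  next
    case False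
    then show thesis using that[of b c d a] abcd(2) unfolding pc4_def by auto
  qed
  show ?thesis
  proof (rule ccontr)
    assume no: "\<not> ?thesis"
    have C: "pc4_set e {x, y, z, w}" unfolding xyzw(1) pc4_set_def using abcd by blast
    have sub: "{x, y, z, w} \<subseteq> V" using xyzw abcd by simp
    have noalt: "\<not> pc4_set e X" if "X \<subseteq> V - {x, y, z, w}" for X
      using no C that sub unfolding two_pc4_def by blast
    have ne: "V - {x, y, z, w} \<noteq> {}"
    proof
      assume "V - {x, y, z, w} = {}"
      then have "nb x True \<subseteq> {y, z, w}" unfolding nb_def by auto
      then show False using nb_not3 sub by blast
    qed
    obtain u c where u: "u \<in> V - {x, y, z, w}"
      and uc: "\<And>m. m \<in> V - {x, y, z, w} \<Longrightarrow> m \<noteq> u \<Longrightarrow> e u m = c"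
      using mono_vertex[OF Diff_subset ne noalt] by blast
    show False
    proof (cases c)
      case True
      then show False using red_vertex_two_pc4[of x y z w u] xyzw sub u uc no by blast
    next
      case False
      interpret N: two_coloring V "\<lambda>x y. \<not> e x y"
      proof
        show "4 \<le> cdeg (\<lambda>x y. \<not> e x y) V v c'" if "v \<in> V" for v c'
          using deg[OF that, of "\<not> c'"] unfolding cdeg_def by (cases c') auto
      qed (use finV sym in auto)
      have "{y, z, w, x} = {x, y, z, w}" by auto
      then show False
        using N.red_vertex_two_pc4[of y z w x u] xyzw sub u uc no False
        by (auto simp: two_pc4_complement)
    qed
  qed
qed

section \<open>Coarsening colorings\<close>

lemma cdeg_mono: "finite V \<Longrightarrow> V' \<subseteq> V \<Longrightarrow> cdeg e V' v c \<le> cdeg e V v c"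
  unfolding cdeg_def by (intro card_mono) auto

lemma pack_if_two_pc4: "two_pc4 e V \<Longrightarrow> pack e 2 V"
proof -
  assume "two_pc4 e V"
  then obtain X Y where XY: "X \<subseteq> V" "Y \<subseteq> V" "X \<inter> Y = {}" "pc4_set e X" "pc4_set e Y"
    unfolding two_pc4_def by blast
  have S: "short_pc_set e X" "short_pc_set e Y" using XY(4,5) unfolding short_pc_set_def by simp_all
  have "Y \<subseteq> V - X" using XY(2,3) by blast
  then have "pack e (Suc 0) (V - X)" using S(2) by (rule pack_SucI) simp
  then have "pack e (Suc (Suc 0)) V" by (rule pack_SucI[OF XY(1) S(1)])
  then show ?thesis by (simp add: numeral_2_eq_2)
qed

text \<open>Only adjacent edges are compared, so \<open>f\<close> need not be a function of the
  colors of \<open>e\<close>: one color may be recolored differently in different parts.\<close>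

lemma pc4_set_coarsen:
  assumes "pc4_set f X" "X \<subseteq> V"
    and "\<And>a b c. a \<in> V \<Longrightarrow> b \<in> V \<Longrightarrow> c \<in> V \<Longrightarrow> f a b \<noteq> f b c \<Longrightarrow> e a b \<noteq> e b c"
  shows "pc4_set e X"
proof -
  obtain a b c d where X: "X = {a, b, c, d}" and pc: "pc4 f a b c d"
    using assms(1) unfolding pc4_set_def by blast
  have m: "a \<in> V" "b \<in> V" "c \<in> V" "d \<in> V" using X assms(2) by auto
  have "pc4 e a b c d"
    using pc assms(3)[OF m(1,2,3)] assms(3)[OF m(2,3,4)] assms(3)[OF m(3,4,1)] assms(3)[OF m(4,1,2)]
    unfolding pc4_def by simp
  then show ?thesis using X unfolding pc4_set_def by blast
qed

lemma pack_coarsen: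
  assumes "pack f k V"
    and "\<And>a b c. f a b \<noteq> f b c \<Longrightarrow> e a b \<noteq> e b c"
  shows "pack e k V"
  using assms(1)
proof (induction k arbitrary: V)
  case (Suc k)
  then obtain X where X: "X \<subseteq> V" "short_pc_set f X" "pack f k (V - X)" by auto
  have "short_pc_set e X"
  proof (cases "pc4_set f X")
    case True
    then show ?thesis using pc4_set_coarsen[OF True subset_refl, of e] assms(2) unfolding short_pc_set_def by blast
  next
    case False
    then obtain a b c where abc: "X = {a, b, c}" "rainbow3 f a b c"
      using X(2) unfolding short_pc_set_def rainbow3_set_def by blast
    then have "rainbow3 e a b c"
      using assms(2)[of a b c] assms(2)[of b c a] assms(2)[of c a b] unfolding rainbow3_def by simp
    then show ?thesis using abc(1) unfolding short_pc_set_def rainbow3_set_def by blast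
  qed
  then show ?case using X Suc.IH by (intro pack_SucI)
qed simp

text \<open>A monochromatic cut is packed greedily: two edges of other colors, one on each side of
  the cut, span a PC cycle of length 4.\<close>

lemma pack_across_cut:
  assumes sym: "\<And>x y. e x y = e y x"
    and "finite A" "finite B" "A \<inter> B = {}" "k = 0 \<or> A \<noteq> {} \<and> B \<noteq> {}"
    and cut: "\<And>a b. a \<in> A \<Longrightarrow> b \<in> B \<Longrightarrow> e a b = i"
    and "\<And>a. a \<in> A \<Longrightarrow> 2 * k \<le> card {w \<in> A. w \<noteq> a \<and> e a w \<noteq> i} + 1"
    and "\<And>b. b \<in> B \<Longrightarrow> 2 * k \<le> card {w \<in> B. w \<noteq> b \<and> e b w \<noteq> i} + 1"
  shows "pack e k (A \<union> B)"
  using assms(2-)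
proof (induction k arbitrary: A B)
  case (Suc k)
  let ?N = "\<lambda>S u. {w \<in> S. w \<noteq> u \<and> e u w \<noteq> i}"
  have edge: "\<exists>a b. a \<in> S \<and> b \<in> S \<and> a \<noteq> b \<and> e a b \<noteq> i \<and> (k = 0 \<or> S - {a, b} \<noteq> {}) \<and>
      (\<forall>u \<in> S - {a, b}. 2 * k \<le> card (?N (S - {a, b}) u) + 1)"
    if S: "finite S" "S \<noteq> {}" "\<And>u. u \<in> S \<Longrightarrow> 2 * Suc k \<le> card (?N S u) + 1" for S
  proof -
    obtain a where a: "a \<in> S" using S by blast
    have "?N S a \<noteq> {}"
    proof
      assume "?N S a = {}"
      then have "card (?N S a) = 0" by (simp only: card.empty)
      then show False using S(3)[OF a] by simp
    qed
    then obtain b where b: "b \<in> S" "b \<noteq> a" "e a b \<noteq> i" by blast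
    \<comment> \<open>Two deleted vertices cost at most two edges, which matches the decrease of
      \<open>2 * Suc k\<close> to \<open>2 * k\<close>.\<close>
    have loss: "card (?N S u) \<le> card (?N (S - {a, b}) u) + 2" for u
    proof -
      have "card (?N S u) \<le> card (?N (S - {a, b}) u \<union> {a, b})"
        using S(1) by (intro card_mono) auto
      also have "\<dots> \<le> card (?N (S - {a, b}) u) + card {a, b}" by (rule card_Un_le)
      finally show ?thesis using b(2) by simp
    qed
    have ne: "S - {a, b} \<noteq> {}" if "k \<noteq> 0"
    proof
      assume "S - {a, b} = {}"
      then have "?N (S - {a, b}) a = {}" by auto
      then have "card (?N (S - {a, b}) a) = 0" by (simp only: card.empty)
      then have "card (?N S a) \<le> 2" using loss[of a] by linarith
      then show False using S(3)[OF a] that by simp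
    qed
    have "2 * k \<le> card (?N (S - {a, b}) u) + 1" if "u \<in> S - {a, b}" for u
    proof -
      have "u \<in> S" using that by blast
      from S(3)[OF this] show ?thesis using loss[of u] by simp
    qed
    then have "\<forall>u \<in> S - {a, b}. 2 * k \<le> card (?N (S - {a, b}) u) + 1" by blast
    moreover have "k = 0 \<or> S - {a, b} \<noteq> {}" using ne by blast
    moreover have "a \<noteq> b" using b(2) by blast
    ultimately show ?thesis using a b(1,3) by blast
  qed
  obtain a b where ab: "a \<in> A" "b \<in> A" "a \<noteq> b" "e a b \<noteq> i" "k = 0 \<or> A - {a, b} \<noteq> {}"
    "\<And>u. u \<in> A - {a, b} \<Longrightarrow> 2 * k \<le> card (?N (A - {a, b}) u) + 1"
    using edge[OF Suc.prems(1) _ Suc.prems(6)] Suc.prems(4) by auto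
  obtain c d where cd: "c \<in> B" "d \<in> B" "c \<noteq> d" "e c d \<noteq> i" "k = 0 \<or> B - {c, d} \<noteq> {}"
    "\<And>u. u \<in> B - {c, d} \<Longrightarrow> 2 * k \<le> card (?N (B - {c, d}) u) + 1"
    using edge[OF Suc.prems(2) _ Suc.prems(7)] Suc.prems(4) by auto
  have dist: "distinct [a, b, c, d]" using ab cd Suc.prems(3) by auto
  moreover have "e b c = i" "e d a = i" using Suc.prems(5) ab cd sym[of d a] by simp_all
  ultimately have "pc4 e a b c d" using ab(4) cd(4) unfolding pc4_def by simp
  then have "short_pc_set e {a, b, c, d}" unfolding short_pc_set_def pc4_set_def by blast
  moreover have "pack e k (A - {a, b} \<union> (B - {c, d}))"
  proof (rule Suc.IH)
    show "e x y = i" if "x \<in> A - {a, b}" "y \<in> B - {c, d}" for x y using Suc.prems(5) that by blast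
  qed (use Suc.prems(1-3) ab cd in auto)
  moreover have "A - {a, b} \<union> (B - {c, d}) = A \<union> B - {a, b, c, d}"
    using ab cd Suc.prems(3) by blast
  ultimately show ?case using ab cd by (intro pack_SucI[of "{a, b, c, d}"]) auto
qed simp

text \<open>In a Gallai part with at least four outside neighbours of color \<open>r\<close>, all colors but \<open>r\<close> may be
  replaced by \<open>q\<close> without violating the degree bound.  Otherwise, by the following lemma, \<open>q\<close> and \<open>r\<close>
  may be exchanged.\<close>

lemma (in gallai_coloring) part_outside_degree:
  assumes q: "q \<noteq> r" and v: "v \<in> V" and v0: "v\<^sub>0 \<in> V" "P v\<^sub>0 \<noteq> P v"
    and between: "\<And>x y. x \<in> V \<Longrightarrow> y \<in> V \<Longrightarrow> P x \<noteq> P y \<Longrightarrow> e x y = q \<or> e x y = r"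
    and module: "\<And>x y z. x \<in> V \<Longrightarrow> y \<in> V \<Longrightarrow> z \<in> V \<Longrightarrow> P x = P y \<Longrightarrow> P z \<noteq> P x \<Longrightarrow> e z x = e z y"
    and deg: "\<And>u c. u \<in> V \<Longrightarrow> cdeg e V u c + 5 \<le> card V"
    and r3: "card {w \<in> V. P w \<noteq> P v \<and> e v w = r} \<le> 3"
  shows "4 \<le> card {w \<in> V. P w \<noteq> P v \<and> e v w = q}"
proof (rule ccontr)
  define X where "X = {w \<in> V. P w = P v}"
  define A where "A = {w \<in> V. P w \<noteq> P v \<and> e v w = q}"
  define B where "B = {w \<in> V. P w \<noteq> P v \<and> e v w = r}"
  assume "\<not> ?thesis"
  then have A3: "card A \<le> 3" and B3: "card B \<le> 3" using r3 unfolding A_def B_def by auto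
  have fin: "finite X" "finite A" "finite B" using finV unfolding X_def A_def B_def by auto
  have disj: "X \<inter> A = {}" "X \<inter> B = {}" "A \<inter> B = {}" using q unfolding X_def A_def B_def by auto
  have V_eq: "V = X \<union> A \<union> B" using between[OF v] unfolding X_def A_def B_def by fastforce
  have cardV: "card V = card X + card A + card B"
    unfolding V_eq using fin disj by (simp add: card_Un_disjoint Int_Un_distrib2)
  have mono: "e y x = e v y" if "x \<in> X" "y \<in> A \<union> B" for x y
    using module[of x v y] that v sym[of v y] unfolding X_def A_def B_def by auto
  \<comment> \<open>\<open>y\<close> sees all of \<open>X\<close> in the color of \<open>vy\<close>,
    so the whole part counts towards one color degree of \<open>y\<close>.\<close>
  have bound: "card X + card {w \<in> S. e y w = c} + 5 \<le> card V"
    if y: "y \<in> A \<union> B" "e v y = c" and S: "S \<subseteq> V" "S \<inter> X = {}" "y \<notin> S" for S y c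
  proof -
    have yV: "y \<in> V" "y \<notin> X" using y disj V_eq by auto
    have "X \<union> {w \<in> S. e y w = c} \<subseteq> {w \<in> V. w \<noteq> y \<and> e y w = c}"
      using mono y S yV V_eq by blast
    then have "card (X \<union> {w \<in> S. e y w = c}) \<le> cdeg e V y c"
      unfolding cdeg_def by (intro card_mono) (use finV in simp_all)
    moreover have "finite {w \<in> S. e y w = c}" using S(1) finV finite_subset by fastforce
    then have "card (X \<union> {w \<in> S. e y w = c}) = card X + card {w \<in> S. e y w = c}"
      using S(2) fin by (intro card_Un_disjoint) auto
    ultimately show ?thesis using deg[OF yV(1), of c] by linarith
  qed
  have v0AB: "v\<^sub>0 \<in> A \<union> B" using v0 V_eq unfolding X_def by blast
  have five: "5 \<le> card A + card B"
    using bound[OF v0AB refl, of "{}"] cardV by simp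
  have V_sub: "A \<subseteq> V" "B \<subseteq> V" and col: "\<And>y. y \<in> A \<Longrightarrow> e v y = q" "\<And>y. y \<in> B \<Longrightarrow> e v y = r"
    unfolding A_def B_def by auto
  let ?m = "card A + card B - 5"
  have a_bound: "card {w \<in> B. e y w = q} \<le> ?m" if "y \<in> A" for y
  proof -
    have "card X + card {w \<in> B. e y w = q} + 5 \<le> card V"
      by (rule bound) (use that V_sub disj col in auto)
    then show ?thesis using cardV by linarith
  qed
  have b_bound: "card {w \<in> A. e y w = r} \<le> ?m" if "y \<in> B" for y
  proof -
    have "card X + card {w \<in> A. e y w = r} + 5 \<le> card V"
      by (rule bound) (use that V_sub disj col in auto)
    then show ?thesis using cardV by linarith
  qed
  \<comment> \<open>Double counting: every pair in \<open>A \<times> B\<close> has color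
    \<open>q\<close> or \<open>r\<close>, so \<open>card A * card B\<close> is at most
    \<open>(card A + card B) * ?m\<close>. For sizes 2 and 3 this reads 6 \<le> 0, for sizes 3 and 3
    it reads 9 \<le> 6.\<close>
  let ?Q = "Sigma A (\<lambda>a. {b \<in> B. e a b = q})" and ?R = "Sigma B (\<lambda>b. {a \<in> A. e b a = r})"
  have "e a b = q \<or> e a b = r" if "a \<in> A" "b \<in> B" for a b
  proof -
    have "v \<noteq> a" "v \<noteq> b" "a \<noteq> b" using that q unfolding A_def B_def by auto
    then show ?thesis
      using norb_cases[of v a b] that v q unfolding A_def B_def by auto
  qed
  then have "A \<times> B \<subseteq> ?Q \<union> prod.swap ` ?R" using sym by force
  then have "card (A \<times> B) \<le> card (?Q \<union> prod.swap ` ?R)"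
    by (intro card_mono) (use fin in auto)
  also have "\<dots> \<le> card ?Q + card (prod.swap ` ?R)" by (rule card_Un_le)
  also have "\<dots> \<le> card ?Q + card ?R"
    by (intro add_left_mono card_image_le) (use fin in auto)
  also have "card ?Q \<le> card A * ?m"
    using sum_bounded_above[of A "\<lambda>a. card {b \<in> B. e a b = q}" ?m] a_bound fin by simp
  also have "card ?R \<le> card B * ?m"
    using sum_bounded_above[of B "\<lambda>b. card {a \<in> A. e b a = r}" ?m] b_bound fin by simp
  finally have "card A * card B \<le> card A * ?m + card B * ?m" by (simp add: card_cartesian_product)
  moreover have "card A = 2 \<and> card B = 3 \<or> card A = 3 \<and> card B = 2 \<or> card A = 3 \<and> card B = 3"
    using A3 B3 five by linarith
  ultimately show False by auto
qed

lemma (in gallai_coloring) pack_two: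
  fixes q r :: 'c
  assumes ne: "V \<noteq> {}" and q: "q \<noteq> r" and two: "\<exists>x\<in>V. \<exists>y\<in>V. P x \<noteq> P y"
    and between: "\<And>x y. x \<in> V \<Longrightarrow> y \<in> V \<Longrightarrow> P x \<noteq> P y \<Longrightarrow> e x y = q \<or> e x y = r"
    and module: "\<And>x y z. x \<in> V \<Longrightarrow> y \<in> V \<Longrightarrow> z \<in> V \<Longrightarrow> P x = P y \<Longrightarrow> P z \<noteq> P x \<Longrightarrow> e z x = e z y"
    and deg: "\<And>u c. u \<in> V \<Longrightarrow> cdeg e V u c + 5 \<le> card V"
  shows "pack e 2 V"
proof -
  define N where "N v c = {w \<in> V. P w \<noteq> P v \<and> e v w = c}" for v c
  define good where "good v \<longleftrightarrow> 4 \<le> card (N v r)" for v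
  \<comment> \<open>\<open>q\<close> becomes red and \<open>r\<close> blue. Any other color on an
    edge of \<open>V\<close> lies inside a part and becomes red or blue according to that part. The
    disjunction makes \<open>red\<close> symmetric without reference to \<open>V\<close>.\<close>
  define red where "red x y \<longleftrightarrow> e x y = q \<or> e x y \<noteq> r \<and> (good x \<or> good y)" for x y
  have good_cong: "good x = good y" if "x \<in> V" "y \<in> V" "P x = P y" for x y
  proof -
    have same: "e x w = e y w" if w: "w \<in> V" "P w \<noteq> P x" for w
      using module[OF \<open>x \<in> V\<close> \<open>y \<in> V\<close> w(1) \<open>P x = P y\<close> w(2)] sym[of w x] sym[of w y] by simp
    have "N x r = N y r"
      unfolding N_def by (rule Collect_cong) (use same that(3) in auto)
    then show ?thesis unfolding good_def by simp
  qed
  have inner: "red x y = good x" if "x \<in> V" "y \<in> V" "e x y \<noteq> q" "e x y \<noteq> r" for x y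
  proof -
    have "P x = P y" using between that by blast
    then have "good x = good y" using good_cong that by blast
    then show ?thesis using that unfolding red_def by blast
  qed
  have red_sym: "red x y = red y x" for x y unfolding red_def using sym[of x y] by auto
  have not_r: "card {w \<in> V. w \<noteq> v \<and> e v w \<noteq> c} \<ge> 4" if "v \<in> V" for v c
    using card_not_color[OF finV that, of e c] deg[OF that, of c] by linarith
  have "4 \<le> cdeg red V v c" if v: "v \<in> V" for v c
  proof -
    obtain v0 where v0: "v0 \<in> V" "P v0 \<noteq> P v" using two by metis
    have le: "4 \<le> cdeg red V v c" if "S \<subseteq> {w \<in> V. w \<noteq> v \<and> red v w = c}" "4 \<le> card S" for S
    proof -
      have "card S \<le> card {w \<in> V. w \<noteq> v \<and> red v w = c}" using that(1) finV by (intro card_mono) simp_all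
      then show ?thesis using that(2) unfolding cdeg_def by linarith
    qed
    \<comment> \<open>In the color given to the inner edges at \<open>v\<close>, all edges avoiding
      one outer color count, and \<open>deg\<close> provides four. In the other color the edges
      leaving the part provide four.\<close>
    show ?thesis
    proof (cases "good v = c")
      case True
      define d where "d = (if c then r else q)"
      have "{w \<in> V. w \<noteq> v \<and> e v w \<noteq> d} \<subseteq> {w \<in> V. w \<noteq> v \<and> red v w = c}"
      proof
        fix w assume "w \<in> {w \<in> V. w \<noteq> v \<and> e v w \<noteq> d}"
        then have w: "w \<in> V" "w \<noteq> v" "e v w \<noteq> d" by auto
        have "red v w = c"
        proof (cases "e v w = q \<or> e v w = r")
          case True
          then show ?thesis using w(3) q unfolding red_def d_def by (cases c) auto
        next
          case False
          then show ?thesis using inner[OF v w(1)] \<open>good v = c\<close> by blast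
        qed
        then show "w \<in> {w \<in> V. w \<noteq> v \<and> red v w = c}" using w by blast
      qed
      then show ?thesis using le not_r[OF v, of d] by blast
    next
      case False
      define d where "d = (if c then q else r)"
      have "N v d \<subseteq> {w \<in> V. w \<noteq> v \<and> red v w = c}"
        using q unfolding N_def red_def d_def by (cases c) auto
      moreover have "4 \<le> card (N v d)"
      proof (cases c)
        case True
        then have "card {w \<in> V. P w \<noteq> P v \<and> e v w = r} \<le> 3"
          using False unfolding good_def N_def by simp
        with q v v0 between module deg
        have "4 \<le> card {w \<in> V. P w \<noteq> P v \<and> e v w = q}" by (rule part_outside_degree)
        then show ?thesis using True unfolding N_def d_def by simp
      next
        case False
        then have "good v" using \<open>good v \<noteq> c\<close> by blast
        then show ?thesis using False unfolding d_def good_def by simp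
      qed
      ultimately show ?thesis using le by blast
    qed
  qed
  then interpret R: two_coloring V red
    by unfold_locales (use finV red_sym in auto)
  \<comment> \<open>Adjacent edges of the same inner color lie in the same part and are recolored
    alike.\<close>
  have coarser: "e a b \<noteq> e b c" if m: "a \<in> V" "b \<in> V" "c \<in> V" and ne: "red a b \<noteq> red b c" for a b c
  proof
    assume eq: "e a b = e b c"
    show False
    proof (cases "e b c = q \<or> e b c = r")
      case True
      then show False using ne eq q unfolding red_def by auto
    next
      case False
      then have "red b c = good b" "red b a = good b"
        using inner[of b c] inner[of b a] m eq sym[of a b] by auto
      then show False using ne red_sym[of a b] by simp
    qed
  qed
  have lift: "pc4_set e X" if "pc4_set red X" "X \<subseteq> V" for X
    using that coarser by (rule pc4_set_coarsen)
  obtain X Y where XY: "X \<subseteq> V" "Y \<subseteq> V" "X \<inter> Y = {}" "pc4_set red X" "pc4_set red Y"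
    using R.two_pc4[OF ne] unfolding two_pc4_def by blast
  have "two_pc4 e V" unfolding two_pc4_def
    using XY(1-3) lift[OF XY(4,1)] lift[OF XY(5,2)] by blast
  then show ?thesis by (rule pack_if_two_pc4)
qed

section \<open>Graphs as colorings of pairs of vertices\<close>

definition pair_color :: "'a ecgraph \<Rightarrow> 'a \<Rightarrow> 'a \<Rightarrow> nat" where
  "pair_color G x y = ecol G {x, y}"

lemma pair_color_sym: "pair_color G x y = pair_color G y x"
  unfolding pair_color_def by (simp add: insert_commute)

lemma edge_iff: "is_complete G \<Longrightarrow> {x, y} \<in> edges G \<longleftrightarrow> x \<in> verts G \<and> y \<in> verts G \<and> x \<noteq> y"
  unfolding is_complete_def by (auto simp: card_insert_if)

lemma edgeE:
  assumes "is_complete G" "e \<in> edges G"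
  obtains x y where "e = {x, y}" "x \<in> verts G" "y \<in> verts G" "x \<noteq> y"
proof -
  have "e \<subseteq> verts G" "card e = 2" using assms unfolding is_complete_def by auto
  then show thesis using that unfolding card_2_iff by blast
qed

lemma finite_verts: "is_complete G \<Longrightarrow> finite (verts G)"
  unfolding is_complete_def is_graph_def by blast

definition pair_colors :: "('a \<Rightarrow> 'a \<Rightarrow> 'c) \<Rightarrow> 'a set \<Rightarrow> 'c set" where
  "pair_colors e V = {e x y | x y. x \<in> V \<and> y \<in> V \<and> x \<noteq> y}"

lemma finite_pair_colors: "finite V \<Longrightarrow> finite (pair_colors e V)"
  unfolding pair_colors_def
  by (rule finite_subset[of _ "(\<lambda>(x, y). e x y) ` (V \<times> V)"]) auto

lemma colors_eq:
  assumes "is_complete G"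
  shows "colors G = pair_colors (pair_color G) (verts G)"
proof
  show "colors G \<subseteq> pair_colors (pair_color G) (verts G)"
    unfolding colors_def pair_colors_def pair_color_def using edgeE[OF assms] by blast
  show "pair_colors (pair_color G) (verts G) \<subseteq> colors G"
    unfolding colors_def pair_colors_def pair_color_def using edge_iff[OF assms] by blast
qed

lemma degree_color_subgraph:
  assumes "is_complete G" "v \<in> verts G"
  shows "degree (color_subgraph G i) v = cdeg (pair_color G) (verts G) v i"
proof -
  have "{e \<in> edges (color_subgraph G i). v \<in> e} =
      (\<lambda>w. {v, w}) ` {w \<in> verts G. w \<noteq> v \<and> pair_color G v w = i}"
  proof
    show "{e \<in> edges (color_subgraph G i). v \<in> e} \<subseteq>
        (\<lambda>w. {v, w}) ` {w \<in> verts G. w \<noteq> v \<and> pair_color G v w = i}"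
    proof
      fix e assume "e \<in> {e \<in> edges (color_subgraph G i). v \<in> e}"
      then have e: "e \<in> edges G" "ecol G e = i" "v \<in> e" unfolding color_subgraph_def by auto
      obtain x y where "e = {x, y}" "x \<in> verts G" "y \<in> verts G" "x \<noteq> y" by (rule edgeE[OF assms(1) e(1)])
      then obtain w where "e = {v, w}" "w \<in> verts G" "w \<noteq> v" using e(3) by auto
      then show "e \<in> (\<lambda>w. {v, w}) ` {w \<in> verts G. w \<noteq> v \<and> pair_color G v w = i}"
        using e(2) unfolding pair_color_def by blast
    qed
    show "(\<lambda>w. {v, w}) ` {w \<in> verts G. w \<noteq> v \<and> pair_color G v w = i} \<subseteq>
        {e \<in> edges (color_subgraph G i). v \<in> e}"
      using edge_iff[OF assms(1)] assms(2) unfolding color_subgraph_def pair_color_def by auto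
  qed
  moreover have "inj_on (\<lambda>w. {v, w}) {w \<in> verts G. w \<noteq> v \<and> pair_color G v w = i}"
    by (rule inj_onI) (auto simp: doubleton_eq_iff)
  ultimately show ?thesis unfolding degree_def cdeg_def by (simp add: card_image)
qed

text \<open>A color that does not occur has degree 0 everywhere, so \<open>i\<close> can range over
  all natural numbers.\<close>

lemma max_mono_degree_le_iff:
  assumes "is_complete G"
  shows "max_mono_degree G \<le> m \<longleftrightarrow> (\<forall>v\<in>verts G. \<forall>i. cdeg (pair_color G) (verts G) v i \<le> m)"
proof -
  have finV: "finite (verts G)" by (rule finite_verts[OF assms])
  then have finC: "finite (colors G)" unfolding colors_eq[OF assms] by (rule finite_pair_colors)
  have "max_degree (color_subgraph G i) \<le> m \<longleftrightarrow> (\<forall>v\<in>verts G. cdeg (pair_color G) (verts G) v i \<le> m)" for i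
  proof -
    have "verts (color_subgraph G i) = verts G" unfolding color_subgraph_def by simp
    then show ?thesis
      unfolding max_degree_def using finV degree_color_subgraph[OF assms] by simp
  qed
  then have "max_mono_degree G \<le> m \<longleftrightarrow>
      (\<forall>i\<in>colors G. \<forall>v\<in>verts G. cdeg (pair_color G) (verts G) v i \<le> m)"
    unfolding max_mono_degree_def using finC by simp
  moreover have "cdeg (pair_color G) (verts G) v i = 0" if "i \<notin> colors G" "v \<in> verts G" for i v
  proof -
    have "{w \<in> verts G. w \<noteq> v \<and> pair_color G v w = i} = {}"
      using that unfolding colors_eq[OF assms] pair_colors_def by blast
    then show ?thesis unfolding cdeg_def by (simp only: card.empty)
  qed
  ultimately show ?thesis by (metis le0)
qed

section \<open>Cycles given as vertex lists and packings of vertex sets\<close>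

lemma cycle_edges_3: "cycle_edges [a, b, c] = {{a, b}, {b, c}, {c, a}}"
proof -
  have "{..<length [a, b, c]} = {0, 1, 2}" by auto
  then show ?thesis unfolding cycle_edges_def by (simp only:) simp
qed

lemma cycle_edges_4: "cycle_edges [a, b, c, d] = {{a, b}, {b, c}, {c, d}, {d, a}}"
proof -
  have "{..<length [a, b, c, d]} = {0, 1, 2, 3}" by auto
  then show ?thesis unfolding cycle_edges_def by (simp only:) simp
qed

lemma pc_cycle_3_iff:
  assumes "is_complete G"
  shows "pc_cycle G [a, b, c] \<longleftrightarrow> {a, b, c} \<subseteq> verts G \<and> rainbow3 (pair_color G) a b c"
proof (cases "distinct [a, b, c]")
  case True
  then show ?thesis
    unfolding pc_cycle_def is_cycle_def cycle_edges_3 rainbow3_def pair_color_def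
    using edge_iff[OF assms] by (auto simp: doubleton_eq_iff)
next
  case False
  then show ?thesis unfolding pc_cycle_def is_cycle_def rainbow3_def by blast
qed

lemma rainbow_triangle_iff:
  assumes "is_complete G"
  shows "rainbow_triangle G [a, b, c] \<longleftrightarrow> {a, b, c} \<subseteq> verts G \<and> rainbow3 (pair_color G) a b c"
proof (cases "distinct [a, b, c]")
  case True
  then show ?thesis
    unfolding rainbow_triangle_def is_cycle_def cycle_edges_3 rainbow3_def pair_color_def
    using edge_iff[OF assms] by (auto simp: doubleton_eq_iff inj_on_def)
next
  case False
  then show ?thesis unfolding rainbow_triangle_def is_cycle_def rainbow3_def by blast
qed

lemma pc_cycle_4_iff:
  assumes "is_complete G"
  shows "pc_cycle G [a, b, c, d] \<longleftrightarrow> {a, b, c, d} \<subseteq> verts G \<and> pc4 (pair_color G) a b c d"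
proof (cases "distinct [a, b, c, d]")
  case True
  then show ?thesis
    unfolding pc_cycle_def is_cycle_def cycle_edges_4 pc4_def pair_color_def
    using edge_iff[OF assms] by (auto simp: doubleton_eq_iff)
next
  case False
  then show ?thesis unfolding pc_cycle_def is_cycle_def pc4_def by blast
qed

lemma short_pc_cycle_cases:
  assumes "pc_cycle G xs" "length xs \<le> 4"
  obtains a b c where "xs = [a, b, c]" | a b c d where "xs = [a, b, c, d]"
proof -
  consider "length xs = 3" | "length xs = 4" using assms unfolding pc_cycle_def is_cycle_def by linarith
  then show thesis
  proof cases
    case 1
    then obtain a b c where "xs = [a, b, c]" by (auto simp: numeral_3_eq_3 length_Suc_conv)
    then show thesis by (rule that(1))
  next
    case 2
    then obtain a b c d where "xs = [a, b, c, d]" by (auto simp: numeral_eq_Suc length_Suc_conv)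
    then show thesis by (rule that(2))
  qed
qed

lemma short_pc_set_if_pc_cycle:
  assumes "is_complete G" "pc_cycle G xs" "length xs \<le> 4"
  shows "short_pc_set (pair_color G) (set xs)"
  using assms(2,3)
proof (cases rule: short_pc_cycle_cases)
  case (1 a b c)
  then have "rainbow3 (pair_color G) a b c" using pc_cycle_3_iff[OF assms(1)] assms(2) by simp
  then show ?thesis unfolding 1 short_pc_set_def rainbow3_set_def by auto
next
  case (2 a b c d)
  then have "pc4 (pair_color G) a b c d" using pc_cycle_4_iff[OF assms(1)] assms(2) by simp
  then show ?thesis unfolding 2 short_pc_set_def pc4_set_def by auto
qed

lemma pc_cycle_if_short_pc_set:
  assumes "is_complete G" "short_pc_set (pair_color G) X" "X \<subseteq> verts G"
  obtains xs where "pc_cycle G xs" "length xs \<le> 4" "set xs = X"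
proof (cases "pc4_set (pair_color G) X")
  case True
  then obtain a b c d where "X = {a, b, c, d}" "pc4 (pair_color G) a b c d"
    unfolding pc4_set_def by blast
  then show thesis using that[of "[a, b, c, d]"] pc_cycle_4_iff[OF assms(1)] assms(3) by simp
next
  case False
  then obtain a b c where "X = {a, b, c}" "rainbow3 (pair_color G) a b c"
    using assms(2) unfolding short_pc_set_def rainbow3_set_def by blast
  then show thesis using that[of "[a, b, c]"] pc_cycle_3_iff[OF assms(1)] assms(3) by simp
qed

lemma disjoint_cycles_if_pack:
  assumes "is_complete G" "pack (pair_color G) k X" "X \<subseteq> verts G"
  shows "\<exists>C. (\<forall>i<k. pc_cycle G (C i) \<and> length (C i) \<le> 4 \<and> set (C i) \<subseteq> X) \<and>
    disjoint_family_on (\<lambda>i. set (C i)) {..<k}"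
  using assms(2,3)
proof (induction k arbitrary: X)
  case 0
  then show ?case by (simp add: disjoint_family_on_def)
next
  case (Suc k)
  then obtain Y where Y: "Y \<subseteq> X" "short_pc_set (pair_color G) Y" "pack (pair_color G) k (X - Y)" by auto
  have "X - Y \<subseteq> verts G" "Y \<subseteq> verts G" using Suc.prems(2) Y(1) by blast+
  then obtain C where C: "\<And>i. i < k \<Longrightarrow> pc_cycle G (C i) \<and> length (C i) \<le> 4 \<and> set (C i) \<subseteq> X - Y"
    and disj: "disjoint_family_on (\<lambda>i. set (C i)) {..<k}"
    using Suc.IH[OF Y(3)] by blast
  obtain xs where xs: "pc_cycle G xs" "length xs \<le> 4" "set xs = Y"
    by (rule pc_cycle_if_short_pc_set[OF assms(1) Y(2) \<open>Y \<subseteq> verts G\<close>])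
  define C' where "C' = C(k := xs)"
  have "pc_cycle G (C' i) \<and> length (C' i) \<le> 4 \<and> set (C' i) \<subseteq> X" if "i < Suc k" for i
    using C[of i] xs Y(1) that unfolding C'_def by (cases "i = k") auto
  moreover have "disjoint_family_on (\<lambda>i. set (C' i)) {..<Suc k}"
    unfolding disjoint_family_on_def
  proof (intro ballI impI)
    fix i j assume ij: "i \<in> {..<Suc k}" "j \<in> {..<Suc k}" "i \<noteq> j"
    consider "i < k" "j < k" | "i = k" "j < k" | "i < k" "j = k" using ij by force
    then show "set (C' i) \<inter> set (C' j) = {}"
    proof cases
      case 1
      then show ?thesis using disj ij(3) unfolding C'_def disjoint_family_on_def by auto
    next
      case 2
      then show ?thesis using C[of j] xs(3) unfolding C'_def by auto
    next
      case 3
      then show ?thesis using C[of i] xs(3) unfolding C'_def by auto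
    qed
  qed
  ultimately show ?case by blast
qed

lemma pack_if_disjoint_cycles:
  assumes "is_complete G" "\<And>i. i < k \<Longrightarrow> pc_cycle G (C i) \<and> length (C i) \<le> 4 \<and> set (C i) \<subseteq> X"
    "disjoint_family_on (\<lambda>i. set (C i)) {..<k}"
  shows "pack (pair_color G) k X"
  using assms(2,3)
proof (induction k arbitrary: X)
  case (Suc k)
  have k: "pc_cycle G (C k)" "length (C k) \<le> 4" "set (C k) \<subseteq> X" using Suc.prems(1)[of k] by auto
  have "set (C i) \<inter> set (C k) = {}" if "i < k" for i
    using Suc.prems(2) that unfolding disjoint_family_on_def by auto
  then have "pc_cycle G (C i) \<and> length (C i) \<le> 4 \<and> set (C i) \<subseteq> X - set (C k)" if "i < k" for i
    using Suc.prems(1)[of i] that by auto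
  moreover have "disjoint_family_on (\<lambda>i. set (C i)) {..<k}"
    using Suc.prems(2) unfolding disjoint_family_on_def by simp
  ultimately have "pack (pair_color G) k (X - set (C k))" by (rule Suc.IH)
  then show ?case
    using short_pc_set_if_pc_cycle[OF assms(1) k(1,2)] k(3) by (intro pack_SucI)
qed simp

lemma has_disjoint_short_pc_cycles_iff:
  assumes "is_complete G"
  shows "has_disjoint_short_pc_cycles G k \<longleftrightarrow> pack (pair_color G) k (verts G)"
proof
  assume "has_disjoint_short_pc_cycles G k"
  then obtain C where C: "\<And>i. i < k \<Longrightarrow> pc_cycle G (C i) \<and> length (C i) \<le> 4"
    and disj: "disjoint_family_on (\<lambda>i. set (C i)) {..<k}"
    unfolding has_disjoint_short_pc_cycles_def by blast
  have "pc_cycle G (C i) \<and> length (C i) \<le> 4 \<and> set (C i) \<subseteq> verts G" if "i < k" for i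
    using C[OF that] unfolding pc_cycle_def is_cycle_def by blast
  then show "pack (pair_color G) k (verts G)"
    using disj by (rule pack_if_disjoint_cycles[OF assms])
next
  assume "pack (pair_color G) k (verts G)"
  then show "has_disjoint_short_pc_cycles G k"
    using disjoint_cycles_if_pack[OF assms _ subset_refl]
    unfolding has_disjoint_short_pc_cycles_def by metis
qed

text \<open>Colorings of pairs instead of graphs, so that a recoloring is just another function. The
  conjunct \<open>3 * k \<le> card V + 1\<close> says that the integer bound is nonnegative, and it
  rules out an empty \<open>V\<close>, for which the degree condition is vacuous.\<close>

definition bad_coloring :: "('a \<Rightarrow> 'a \<Rightarrow> 'c) \<Rightarrow> 'a set \<Rightarrow> nat \<Rightarrow> bool" where
  "bad_coloring e V k \<longleftrightarrow> finite V \<and> k \<ge> 1 \<and> 3 * k \<le> card V + 1 \<and>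
     (\<forall>v\<in>V. \<forall>c. cdeg e V v c + 3 * k \<le> card V + 1) \<and> \<not> pack e k V"

lemma counterexample_iff:
  "counterexample G k \<longleftrightarrow> is_complete G \<and> bad_coloring (pair_color G) (verts G) k"
proof (cases "is_complete G")
  case True
  define m where "m = max_mono_degree G"
  define n where "n = card (verts G)"
  have "int m \<le> int n - 3 * int k + 1 \<longleftrightarrow> m + 3 * k \<le> n + 1" by (rule iffI; linarith)
  also have "\<dots> \<longleftrightarrow> 3 * k \<le> n + 1 \<and> m \<le> n + 1 - 3 * k" by arith
  also have "\<dots> \<longleftrightarrow> 3 * k \<le> n + 1 \<and> (\<forall>v\<in>verts G. \<forall>i. cdeg (pair_color G) (verts G) v i \<le> n + 1 - 3 * k)"
    unfolding m_def max_mono_degree_le_iff[OF True] ..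
  also have "\<dots> \<longleftrightarrow> 3 * k \<le> n + 1 \<and> (\<forall>v\<in>verts G. \<forall>i. cdeg (pair_color G) (verts G) v i + 3 * k \<le> n + 1)"
    by (rule conj_cong) (simp_all add: le_diff_conv2)
  finally show ?thesis
    unfolding m_def n_def counterexample_def bad_coloring_def has_disjoint_short_pc_cycles_iff[OF True]
    using True finite_verts[OF True] by blast
next
  case False
  then show ?thesis unfolding counterexample_def by blast
qed

lemma pack_image:
  assumes "pack (\<lambda>i j. e (g i) (g j)) k A" "inj_on g A"
  shows "pack e k (g ` A)"
  using assms
proof (induction k arbitrary: A)
  case (Suc k)
  let ?f = "\<lambda>i j. e (g i) (g j)"
  obtain X where X: "X \<subseteq> A" "short_pc_set ?f X" "pack ?f k (A - X)" using Suc.prems(1) by auto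
  have inj: "g x = g y \<longleftrightarrow> x = y" if "x \<in> X" "y \<in> X" for x y
    using that X(1) Suc.prems(2) unfolding inj_on_def by blast
  have "short_pc_set e (g ` X)"
  proof (cases "pc4_set ?f X")
    case True
    then obtain a b c d where abcd: "X = {a, b, c, d}" "pc4 ?f a b c d" unfolding pc4_set_def by blast
    then have "pc4 e (g a) (g b) (g c) (g d)" using inj unfolding pc4_def by simp
    then show ?thesis unfolding abcd(1) short_pc_set_def pc4_set_def by auto
  next
    case False
    then obtain a b c where abc: "X = {a, b, c}" "rainbow3 ?f a b c"
      using X(2) unfolding short_pc_set_def rainbow3_set_def by blast
    then have "rainbow3 e (g a) (g b) (g c)" using inj unfolding rainbow3_def by simp
    then show ?thesis unfolding abc(1) short_pc_set_def rainbow3_set_def by auto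
  qed
  moreover have "g ` A - g ` X = g ` (A - X)"
    using X(1) Suc.prems(2) by (simp add: inj_on_image_set_diff)
  then have "pack e k (g ` A - g ` X)"
    using Suc.IH[OF X(3)] Suc.prems(2) inj_on_subset by fastforce
  ultimately show ?case using X(1) by (intro pack_SucI) auto
qed simp

text \<open>Minimality compares only with graphs on natural numbers, so a modified coloring becomes
  a competitor after renaming its vertices.\<close>

lemma ex_counterexample_nat:
  fixes e :: "'a \<Rightarrow> 'a \<Rightarrow> nat"
  assumes sym: "\<And>x y. e x y = e y x" and bad: "bad_coloring e V k"
  obtains H :: "nat ecgraph" where "counterexample H k" "card (verts H) = card V"
    "card (colors H) = card (pair_colors e V)"
proof -
  let ?n = "card V"
  have finV: "finite V" using bad unfolding bad_coloring_def by blast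
  then obtain g where g: "bij_betw g {..<?n} V"
    using ex_bij_betw_nat_finite[OF finV] by (metis atLeast0LessThan)
  have inj: "inj_on g {..<?n}" and img: "g ` {..<?n} = V" using g unfolding bij_betw_def by auto
  \<comment> \<open>\<open>Min\<close> and \<open>Max\<close> turn an edge into an ordered pair; by
    symmetry of \<open>e\<close> the order is irrelevant.\<close>
  define H :: "nat ecgraph" where
    "H = \<lparr>verts = {..<?n}, edges = {S. S \<subseteq> {..<?n} \<and> card S = 2}, ecol = (\<lambda>S. e (g (Min S)) (g (Max S)))\<rparr>"
  have H: "is_complete H" "verts H = {..<?n}" unfolding H_def is_complete_def is_graph_def by auto
  have col: "pair_color H = (\<lambda>i j. e (g i) (g j))"
    unfolding pair_color_def H_def using sym by (auto simp: fun_eq_iff min_def max_def)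
  have deg: "cdeg (pair_color H) {..<?n} i c = cdeg e V (g i) c" if "i < ?n" for i c
  proof -
    have "g ` {j \<in> {..<?n}. j \<noteq> i \<and> e (g i) (g j) = c} = {w \<in> V. w \<noteq> g i \<and> e (g i) w = c}"
      using img inj that unfolding inj_on_def by auto
    moreover have "inj_on g {j \<in> {..<?n}. j \<noteq> i \<and> e (g i) (g j) = c}"
      using inj by (rule inj_on_subset) auto
    ultimately show ?thesis unfolding cdeg_def col by (metis (no_types, lifting) card_image)
  qed
  have degH: "cdeg (pair_color H) {..<?n} i c + 3 * k \<le> ?n + 1" if "i < ?n" for i c
  proof -
    have "g i \<in> V" using img that by blast
    then show ?thesis using deg[OF that] bad unfolding bad_coloring_def by metis
  qed
  have "\<not> pack (pair_color H) k {..<?n}"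
    using pack_image[of e g k "{..<?n}"] inj bad unfolding col img bad_coloring_def by blast
  then have "bad_coloring (pair_color H) (verts H) k"
    using bad degH unfolding bad_coloring_def H(2) by simp
  then have "counterexample H k" using H(1) counterexample_iff by blast
  moreover have "pair_colors (pair_color H) {..<?n} = pair_colors e V"
    unfolding pair_colors_def col
  proof (intro set_eqI iffI)
    fix c assume "c \<in> {e (g x) (g y) |x y. x \<in> {..<?n} \<and> y \<in> {..<?n} \<and> x \<noteq> y}"
    then show "c \<in> {e x y |x y. x \<in> V \<and> y \<in> V \<and> x \<noteq> y}"
      using img inj unfolding inj_on_def by blast
  next
    fix c assume "c \<in> {e x y |x y. x \<in> V \<and> y \<in> V \<and> x \<noteq> y}"
    then obtain x y where xy: "c = e x y" "x \<in> V" "y \<in> V" "x \<noteq> y" by blast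
    then have "x \<in> g ` {..<?n}" "y \<in> g ` {..<?n}" by (simp_all only: img)
    then obtain i j where "i \<in> {..<?n}" "j \<in> {..<?n}" "x = g i" "y = g j" by blast
    then show "c \<in> {e (g x) (g y) |x y. x \<in> {..<?n} \<and> y \<in> {..<?n} \<and> x \<noteq> y}"
      using xy by blast
  qed
  then have "card (colors H) = card (pair_colors e V)" using colors_eq[OF H(1)] H(2) by simp
  ultimately show thesis using that H(2) by simp
qed

section \<open>Minimum counterexamples\<close>

text \<open>Three vertices fewer and \<open>k\<close> smaller by one leave n - 3k + 1 unchanged,
  color degrees do not grow, and a packing of the rest would extend by the triangle.\<close>

lemma bad_coloring_remove_triangle:
  assumes bad: "bad_coloring e V k" and k: "k \<noteq> 1" and abc: "{a, b, c} \<subseteq> V" "rainbow3 e a b c"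
  shows "bad_coloring e (V - {a, b, c}) (k - 1)"
proof -
  let ?V = "V - {a, b, c}"
  have k2: "2 \<le> k" and finV: "finite V" using bad k unfolding bad_coloring_def by auto
  have "card {a, b, c} = 3" using abc(2) unfolding rainbow3_def by simp
  then have card: "card ?V + 3 = card V"
    using card_Diff_subset[OF _ abc(1)] card_mono[OF finV abc(1)] by simp
  have "short_pc_set e {a, b, c}" using abc(2) unfolding short_pc_set_def rainbow3_set_def by blast
  then have "\<not> pack e (k - 1) ?V"
    using pack_SucI[OF abc(1), of e "k - 1"] bad k2 unfolding bad_coloring_def by auto
  moreover have "cdeg e ?V v i + 3 * (k - 1) \<le> card ?V + 1" if "v \<in> ?V" for v i
  proof -
    have "cdeg e V v i + 3 * k \<le> card V + 1" using bad that unfolding bad_coloring_def by blast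
    then show ?thesis using cdeg_mono[OF finV Diff_subset, of e "{a, b, c}" v i] card k2 by linarith
  qed
  moreover have "3 * (k - 1) \<le> card ?V + 1" using bad card k2 unfolding bad_coloring_def by linarith
  ultimately show ?thesis using finV k2 unfolding bad_coloring_def by simp
qed

lemma pack_1_if_rainbow3:
  assumes "{a, b, c} \<subseteq> V" "rainbow3 e a b c"
  shows "pack e 1 V"
proof -
  have "short_pc_set e {a, b, c}" using assms(2) unfolding short_pc_set_def rainbow3_set_def by blast
  with assms(1) have "pack e (Suc 0) V" by (rule pack_SucI) simp
  then show ?thesis by simp
qed

text \<open>The degree bound leaves a slack of 3k - 1 below the number of vertices. Deleting at most
  k - 1 vertices keeps 2k, so a vertex on no PC cycle of length 4 would yield a packing.\<close>

lemma pc4_avoiding: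
  fixes e :: "'a \<Rightarrow> 'a \<Rightarrow> nat"
  assumes gal: "gallai_coloring V e" and bad: "bad_coloring e V k"
    and S: "S \<subseteq> V" "card S \<le> k - 1" and v: "v \<in> V - S"
  obtains a x b where "{v, a, x, b} \<subseteq> V - S" "pc4 e v a x b"
proof (rule ccontr)
  interpret gallai_coloring V e by (rule gal)
  assume no: "\<not> thesis"
  have k: "k \<ge> 1" using bad unfolding bad_coloring_def by blast
  have card: "card (V - S) = card V - card S" "card S \<le> card V"
    using S(1) finV by (simp_all add: card_Diff_subset finite_subset card_mono)
  have "pack e k (V - S)"
  proof (rule pack_if_vertex_in_no_pc4[OF _ sym _ v k])
    show "cdeg e (V - S) u c + 2 * k \<le> card (V - S)" if "u \<in> V - S" for u c
    proof -
      have "cdeg e V u c + 3 * k \<le> card V + 1" using bad that unfolding bad_coloring_def by blast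
      then show ?thesis using cdeg_mono[OF finV Diff_subset, of e S u c] card S(2) k by linarith
    qed
    show "\<not> pc4 e v a x b" if "a \<in> V - S" "x \<in> V - S" "b \<in> V - S" for a x b
      using no \<open>\<And>a x b. {v, a, x, b} \<subseteq> V - S \<Longrightarrow> pc4 e v a x b \<Longrightarrow> thesis\<close> that v by blast
  qed (use finV norb in auto)
  then show False using bad pack_mono[of e k "V - S" V] unfolding bad_coloring_def by blast
qed

lemma no_mono_cut:
  assumes sym: "\<And>x y. e x y = e y x" and bad: "bad_coloring e V k"
    and cut: "A \<noteq> {}" "B \<noteq> {}" "A \<inter> B = {}" "A \<union> B = V"
  shows "\<not> (\<forall>a\<in>A. \<forall>b\<in>B. e a b = i)"
proof
  assume mono: "\<forall>a\<in>A. \<forall>b\<in>B. e a b = i"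
  have finV: "finite V" and k: "k \<ge> 1" using bad unfolding bad_coloring_def by auto
  \<comment> \<open>The edges across the cut have color \<open>i\<close>, so the at least 3k - 2
    edges of other colors at \<open>u\<close> stay on its side, and 3k - 2 \<ge> 2k - 1.\<close>
  have deg: "2 * k \<le> card {w \<in> S. w \<noteq> u \<and> e u w \<noteq> i} + 1"
    if "S \<subseteq> V" "u \<in> S" "\<And>w. w \<in> V - S \<Longrightarrow> e u w = i" for S u
  proof -
    have "u \<in> V" using that by blast
    have "{w \<in> V. w \<noteq> u \<and> e u w \<noteq> i} = {w \<in> S. w \<noteq> u \<and> e u w \<noteq> i}" using that by blast
    moreover have "cdeg e V u i + 3 * k \<le> card V + 1" using bad \<open>u \<in> V\<close> unfolding bad_coloring_def by blast
    ultimately show ?thesis using card_not_color[OF finV \<open>u \<in> V\<close>, of e i] k by simp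
  qed
  have "pack e k (A \<union> B)"
  proof (rule pack_across_cut[OF sym])
    show "2 * k \<le> card {w \<in> A. w \<noteq> a \<and> e a w \<noteq> i} + 1" if "a \<in> A" for a
      by (rule deg) (use that cut mono in blast)+
    show "2 * k \<le> card {w \<in> B. w \<noteq> b \<and> e b w \<noteq> i} + 1" if b: "b \<in> B" for b
    proof (rule deg)
      show "e b w = i" if "w \<in> V - B" for w using that b cut mono sym[of b w] by auto
    qed (use b cut in blast)+
    show "finite A" "finite B" using finV cut(4) by auto
  qed (use cut mono in auto)
  then show False using bad cut(4) unfolding bad_coloring_def by simp
qed

text \<open>A single color would have degree n - 1, which exceeds n - 3k + 1.\<close>

lemma bad_coloring_two_colors:
  assumes bad: "bad_coloring e V k"
  shows "2 \<le> card (pair_colors e V)"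
proof (rule ccontr)
  have finV: "finite V" and k: "k \<ge> 1" "3 * k \<le> card V + 1" using bad unfolding bad_coloring_def by auto
  assume "\<not> ?thesis"
  then have "card (pair_colors e V) \<le> Suc 0" by simp
  then have eq: "\<forall>x\<in>pair_colors e V. \<forall>y\<in>pair_colors e V. x = y"
    by (simp only: card_le_Suc0_iff_eq[OF finite_pair_colors[OF finV]])
  have "2 \<le> card V" using k by linarith
  then have "\<not> card V \<le> Suc 0" by simp
  then obtain u w where u: "u \<in> V" "w \<in> V" "u \<noteq> w"
    unfolding card_le_Suc0_iff_eq[OF finV] by blast
  have "e u x = e u w" if "x \<in> V" "x \<noteq> u" for x
  proof -
    have "e u x \<in> pair_colors e V" "e u w \<in> pair_colors e V"
      unfolding pair_colors_def using that u by blast+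
    then show ?thesis using eq by blast
  qed
  then have "{x \<in> V. x \<noteq> u \<and> e u x \<noteq> e u w} = {}" by blast
  then have "card {x \<in> V. x \<noteq> u \<and> e u x \<noteq> e u w} = 0" by (simp only: card.empty)
  then have "cdeg e V u (e u w) + 1 = card V" using card_not_color[OF finV u(1), of e "e u w"] by linarith
  moreover have "cdeg e V u (e u w) + 3 * k \<le> card V + 1" using bad u(1) unfolding bad_coloring_def by blast
  ultimately show False using k(1) by linarith
qed

text \<open>Two colors that occur only inside Gallai parts may be merged: a vertex outside a part sees
  the whole part in one color, so a part is no larger than the maximum monochromatic degree.\<close>

lemma bad_coloring_merge_colors:
  fixes e :: "'a \<Rightarrow> 'a \<Rightarrow> nat"
  assumes gal: "gallai_coloring V e" and bad: "bad_coloring e V k"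
    and many: "4 \<le> card (pair_colors e V)"
  obtains f :: "'a \<Rightarrow> 'a \<Rightarrow> nat" where "\<And>x y. f x y = f y x" "bad_coloring f V k"
    "card (pair_colors f V) < card (pair_colors e V)"
proof -
  interpret gallai_coloring V e by (rule gal)
  have k: "k \<ge> 1" "3 * k \<le> card V + 1" using bad unfolding bad_coloring_def by auto
  then have V2: "card V \<ge> 2" by linarith
  obtain P :: "'a \<Rightarrow> 'a set" and q r where q: "q \<noteq> r"
    and two: "\<exists>x\<in>V. \<exists>y\<in>V. P x \<noteq> P y"
    and between: "\<And>x y. x \<in> V \<Longrightarrow> y \<in> V \<Longrightarrow> P x \<noteq> P y \<Longrightarrow> e x y = q \<or> e x y = r"
    and module: "\<And>x y z. x \<in> V \<Longrightarrow> y \<in> V \<Longrightarrow> z \<in> V \<Longrightarrow> P x = P y \<Longrightarrow> P z \<noteq> P x \<Longrightarrow> e z x = e z y"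
    by (rule gallai_partition[OF gal V2]) blast
  have fin: "finite (pair_colors e V)" by (rule finite_pair_colors[OF finV])
  have "card (pair_colors e V) - card {q, r} \<le> card (pair_colors e V - {q, r})"
    by (rule diff_card_le_card_Diff) simp
  \<comment> \<open>At most \<open>q\<close> and \<open>r\<close> occur between parts, so at least
    two of the four colors occur only inside parts.\<close>
  then have "\<not> card (pair_colors e V - {q, r}) \<le> Suc 0" using many q by simp
  then obtain s t where st: "s \<in> pair_colors e V" "t \<in> pair_colors e V" "s \<noteq> t" "s \<notin> {q, r}" "t \<notin> {q, r}"
    unfolding card_le_Suc0_iff_eq[OF finite_Diff[OF fin]] by blast
  define f where "f x y = (if e x y = t then s else e x y)" for x y
  have f_sym: "f x y = f y x" for x y unfolding f_def using sym[of x y] by simp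
  have "pair_colors f V \<subseteq> pair_colors e V - {t}"
    using st unfolding pair_colors_def f_def by auto
  then have "pair_colors f V \<subset> pair_colors e V" using st(2) by blast
  then have fewer: "card (pair_colors f V) < card (pair_colors e V)" using fin psubset_card_mono by blast
  have "cdeg f V v c + 3 * k \<le> card V + 1" if v: "v \<in> V" for v c
  proof -
    have "\<exists>u\<in>V. \<exists>d. cdeg f V v c \<le> cdeg e V u d"
    proof (cases "c = s")
      case False
      have "cdeg f V v c \<le> cdeg e V v c"
        unfolding cdeg_def f_def using finV False by (intro card_mono) auto
      then show ?thesis using v by blast
    next
      case True
      obtain u where u: "u \<in> V" "P u \<noteq> P v" using two by metis
      have "{w \<in> V. w \<noteq> v \<and> f v w = c} \<subseteq> {w \<in> V. w \<noteq> u \<and> e u w = e u v}"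
      proof
        fix w assume "w \<in> {w \<in> V. w \<noteq> v \<and> f v w = c}"
        then have w: "w \<in> V" "e v w = s \<or> e v w = t" using True unfolding f_def by (auto split: if_splits)
        then have "P v = P w" using between[OF v w(1)] st(4,5) by auto
        then have "e u v = e u w" "w \<noteq> u" using module[OF v w(1) u(1) _ u(2)] u(2) by auto
        then show "w \<in> {w \<in> V. w \<noteq> u \<and> e u w = e u v}" using w(1) by simp
      qed
      then have "cdeg f V v c \<le> cdeg e V u (e u v)"
        unfolding cdeg_def using finV by (intro card_mono) auto
      then show ?thesis using u(1) by blast
    qed
    then obtain u d where "u \<in> V" "cdeg f V v c \<le> cdeg e V u d" by blast
    moreover from this(1) have "cdeg e V u d + 3 * k \<le> card V + 1" using bad unfolding bad_coloring_def by blast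
    ultimately show ?thesis by linarith
  qed
  moreover have "\<not> pack f k V"
  proof
    assume "pack f k V"
    then have "pack e k V" by (rule pack_coarsen) (auto simp: f_def split: if_splits)
    then show False using bad unfolding bad_coloring_def by blast
  qed
  ultimately have "bad_coloring f V k" using bad unfolding bad_coloring_def by blast
  then show thesis using that f_sym fewer by blast
qed

text \<open>For \<open>k = 1\<close> the cycle of \<open>pc4_avoiding\<close> with nothing deleted
  is a packing. For \<open>k = 2\<close> the degree bound is the one of
  \<open>pack_two\<close>.\<close>

lemma bad_coloring_ge_3:
  fixes e :: "'a \<Rightarrow> 'a \<Rightarrow> nat"
  assumes gal: "gallai_coloring V e" and bad: "bad_coloring e V k"
  shows "3 \<le> k"
proof (rule ccontr)
  interpret gallai_coloring V e by (rule gal)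
  have k: "k \<ge> 1" "3 * k \<le> card V + 1" using bad unfolding bad_coloring_def by auto
  then have V2: "card V \<ge> 2" by linarith
  then obtain v where v: "v \<in> V" by fastforce
  assume "\<not> ?thesis"
  then consider "k = 1" | "k = 2" using k(1) by linarith
  then show False
  proof cases
    case 1
    obtain a x b where "{v, a, x, b} \<subseteq> V - {}" "pc4 e v a x b"
      using pc4_avoiding[OF gal bad, of "{}" v] v by auto
    then have "{v, a, x, b} \<subseteq> V" "short_pc_set e {v, a, x, b}"
      unfolding short_pc_set_def pc4_set_def by blast+
    then have "pack e (Suc 0) V" by (rule pack_SucI) simp
    then show False using bad 1 unfolding bad_coloring_def by simp
  next
    case 2
    obtain P :: "'a \<Rightarrow> 'a set" and q r where P: "q \<noteq> r" "\<exists>x\<in>V. \<exists>y\<in>V. P x \<noteq> P y"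
      "\<And>x y. x \<in> V \<Longrightarrow> y \<in> V \<Longrightarrow> P x \<noteq> P y \<Longrightarrow> e x y = q \<or> e x y = r"
      "\<And>x y z. x \<in> V \<Longrightarrow> y \<in> V \<Longrightarrow> z \<in> V \<Longrightarrow> P x = P y \<Longrightarrow> P z \<noteq> P x \<Longrightarrow> e z x = e z y"
      by (rule gallai_partition[OF gal V2]) blast
    have ne: "V \<noteq> {}" using v by blast
    have "cdeg e V u c + 5 \<le> card V" if "u \<in> V" for u c
    proof -
      have "cdeg e V u c + 3 * k \<le> card V + 1" using bad that unfolding bad_coloring_def by blast
      then show ?thesis using 2 by linarith
    qed
    with ne P have "pack e 2 V" by (rule pack_two)
    then show False using bad 2 unfolding bad_coloring_def by simp
  qed
qed

theorem theorem17:
  fixes G :: "'a ecgraph" and k :: nat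
  assumes "minimum_counterexample G k"
  shows "k \<ge> 3
    \<and> (card (colors G) = 2 \<or> card (colors G) = 3)
    \<and> (\<nexists>xs. rainbow_triangle G xs)
    \<and> \<not> has_mono_edge_cut G
    \<and> (\<forall>S v. S \<subseteq> verts G \<and> card S \<le> k - 1 \<and> v \<in> verts G - S \<longrightarrow>
          (\<exists>xs. pc_cycle (delete_verts G S) xs \<and> length xs = 4 \<and> v \<in> set xs))"
proof -
  define V where "V = verts G"
  define e where "e = pair_color G"
  have sym: "e x y = e y x" for x y unfolding e_def by (rule pair_color_sym)
  have cex: "counterexample G k" using assms unfolding minimum_counterexample_def by blast
  then have G: "is_complete G" and bad: "bad_coloring e V k"
    unfolding counterexample_iff e_def V_def by auto
  have col: "colors G = pair_colors e V" unfolding e_def V_def by (rule colors_eq[OF G])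
  have finV: "finite V" and k1: "k \<ge> 1" using bad unfolding bad_coloring_def by auto
  \<comment> \<open>Minimality restated for symmetric colorings of pairs over the vertex type of
    \<open>G\<close>, by transfer to natural numbers.\<close>
  have min: "k \<le> l \<and> (l = k \<longrightarrow> card V \<le> card U \<and>
      (card U = card V \<longrightarrow> card (colors G) \<le> card (pair_colors f U)))"
    if f: "\<And>x y. f x y = f y x" "bad_coloring f U l" for f :: "'a \<Rightarrow> 'a \<Rightarrow> nat" and U l
  proof -
    obtain H :: "nat ecgraph" where "counterexample H l" "card (verts H) = card U"
      "card (colors H) = card (pair_colors f U)"
      by (rule ex_counterexample_nat[OF f])
    then show ?thesis using assms unfolding minimum_counterexample_def V_def by metis
  qed
  have norb: "\<not> rainbow3 e a b c" if abc: "{a, b, c} \<subseteq> V" for a b c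
  proof
    assume rb: "rainbow3 e a b c"
    show False
    proof (cases "k = 1")
      case True
      then show False using pack_1_if_rainbow3[OF abc rb] bad unfolding bad_coloring_def by simp
    next
      case False
      then have "k \<le> k - 1" using min[OF sym bad_coloring_remove_triangle[OF bad False abc rb]] by blast
      then show False using k1 by linarith
    qed
  qed
  have gal: "gallai_coloring V e"
    by unfold_locales (use finV sym norb in auto)
  have a: "k \<ge> 3" by (rule bad_coloring_ge_3[OF gal bad])
  have "\<not> 4 \<le> card (pair_colors e V)"
  proof
    assume "4 \<le> card (pair_colors e V)"
    then obtain f :: "'a \<Rightarrow> 'a \<Rightarrow> nat" where "\<And>x y. f x y = f y x" "bad_coloring f V k"
      "card (pair_colors f V) < card (pair_colors e V)"
      using bad_coloring_merge_colors[OF gal bad] by metis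
    then show False using min[of f V k] col by simp
  qed
  then have b: "card (colors G) = 2 \<or> card (colors G) = 3"
    using bad_coloring_two_colors[OF bad] unfolding col by linarith
  have c: "\<nexists>xs. rainbow_triangle G xs"
  proof
    assume "\<exists>xs. rainbow_triangle G xs"
    then obtain xs where xs: "rainbow_triangle G xs" by blast
    then obtain a b c where "xs = [a, b, c]"
      unfolding rainbow_triangle_def by (auto simp: numeral_3_eq_3 length_Suc_conv)
    then show False using xs norb rainbow_triangle_iff[OF G] unfolding e_def V_def by blast
  qed
  have d: "\<not> has_mono_edge_cut G"
  proof
    assume "has_mono_edge_cut G"
    then obtain A B i where AB: "A \<noteq> {}" "B \<noteq> {}" "A \<inter> B = {}" "A \<union> B = V"
      and i: "\<forall>u\<in>A. \<forall>v\<in>B. {u, v} \<in> edges G \<longrightarrow> ecol G {u, v} = i"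
      unfolding has_mono_edge_cut_def V_def by blast
    have "e u v = i" if "u \<in> A" "v \<in> B" for u v
    proof -
      have "{u, v} \<in> edges G" using edge_iff[OF G] AB that unfolding V_def by blast
      then show ?thesis using i that unfolding e_def pair_color_def by blast
    qed
    then show False using no_mono_cut[OF sym bad AB] by blast
  qed
  have "\<exists>xs. pc_cycle (delete_verts G S) xs \<and> length xs = 4 \<and> v \<in> set xs"
    if S: "S \<subseteq> V" "card S \<le> k - 1" and v: "v \<in> V - S" for S v
  proof -
    obtain a x b where pc: "{v, a, x, b} \<subseteq> V - S" "pc4 e v a x b"
      by (rule pc4_avoiding[OF gal bad S v])
    have GS: "is_complete (delete_verts G S)" "verts (delete_verts G S) = V - S"
      using G unfolding is_complete_def is_graph_def delete_verts_def V_def by auto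
    have "pair_color (delete_verts G S) = e"
      unfolding e_def pair_color_def delete_verts_def by simp
    then have "pc_cycle (delete_verts G S) [v, a, x, b]"
      using pc pc_cycle_4_iff[OF GS(1)] GS(2) by simp
    then show ?thesis by (intro exI[of _ "[v, a, x, b]"]) simp
  qed
  then show ?thesis using a b c d unfolding V_def by blast
qed

end
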